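(* There exist absolute constants $\widetilde{c},c_1,c_2>0$ such that the following holds. Let $(\beta_1,\beta_2)\in\mathbb{R}^k\times\mathbb{R}^k$ be fixed (so not depending on the samples below), put $\mathrm{err}:=\max\{\|\beta_1-\beta_1^*\|_2,\|\beta_2-\beta_2^*\|_2\}$, and let $\mathcal{S}$ be a set of samples from the noiseless mixed linear regression model with parameters $\beta_1^*,\beta_2^*$ and fractions $p_1,p_2$. Let $(\beta_1^+,\beta_2^+)$ be the output of one EM iteration started at $(\beta_1,\beta_2)$ and run on $\mathcal{S}$, and put $\mathrm{err}^+:=\max\{\|\beta_1^+-\beta_1^*\|_2,\|\beta_2^+-\beta_2^*\|_2\}$. If $$\mathrm{err}\le \widetilde{c}\,\min\{p_1,p_2\}\,\|\beta_1^*-\beta_2^*\|_2\qquad\text{and}\qquad |\mathcal{S}|\ge \left(\frac{c_1}{\min\{p_1,p_2\}}\right)k ,$$ then, with probability greater than $1-\exp(-c_2k)$ over the samples, $$\mathrm{err}^+\le \tfrac12\,\mathrm{err}.$$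
   Context: Noiseless mixed linear regression model: $\beta_1^*,\beta_2^*\in\mathbb{R}^k$ are distinct vectors with $\|\beta_1^*\|_2=\|\beta_2^*\|_2=1$. A sample set $\mathcal{S}$ consists of pairs $(y_i,\mathbf{x}_i)$, where the $\mathbf{x}_i\sim\mathcal{N}(0,I_k)$ are i.i.d. and $y_i=z_i\langle \mathbf{x}_i,\beta_1^*\rangle+(1-z_i)\langle\mathbf{x}_i,\beta_2^*\rangle$ with unobserved labels $z_i\in\{0,1\}$ not depending on the $\mathbf{x}_i$. The numbers $p_1,p_2>0$, $p_1+p_2=1$, are the fractions of samples in $\mathcal{S}$ that come from $\beta_1^*$ (those with $z_i=1$) and from $\beta_2^*$ (those with $z_i=0$) respectively. One EM iteration from $(\beta_1,\beta_2)$ on $\mathcal{S}$: set $J_1=\{i\in\mathcal{S}: |y_i-\langle\mathbf{x}_i,\beta_1\rangle|<|y_i-\langle\mathbf{x}_i,\beta_2\rangle|\}$ and $J_2=\mathcal{S}\setminus J_1$, and let $\beta_b^+\in\arg\min_{\beta\in\mathbb{R}^k}\sum_{i\in J_b}(y_i-\langle\mathbf{x}_i,\beta\rangle)^2$ for $b=1,2$. *)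

theory Defs
  imports "HOL-Probability.Probability"
begin

text \<open>
  The constants of the theorem must not depend on the dimension \<open>k\<close>, so \<open>k\<close> has to be quantified
  inside the statement and cannot be a type. Vectors are therefore the extensional functions on
  \<open>{..<k}\<close>, which is also the underlying space of \<open>Pi\<^sub>M {..<k} (\<lambda>_. borel)\<close>. Inner products and
  norms only look at the coordinates below \<open>k\<close>.
\<close>

type_synonym rvec = "nat \<Rightarrow> real"

definition vecs :: "nat \<Rightarrow> rvec set" where
  "vecs k = ({..<k} \<rightarrow>\<^sub>E (UNIV :: real set))"

definition iprod :: "nat \<Rightarrow> rvec \<Rightarrow> rvec \<Rightarrow> real" where
  "iprod k u v = (\<Sum>j<k. u j * v j)"

definition vnorm :: "nat \<Rightarrow> rvec \<Rightarrow> real" where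
  "vnorm k u = L2_set u {..<k}"

definition vdist :: "nat \<Rightarrow> rvec \<Rightarrow> rvec \<Rightarrow> real" where
  "vdist k u v = vnorm k (\<lambda>j. u j - v j)"

definition std_gaussian :: "nat \<Rightarrow> rvec measure" where
  "std_gaussian k = Pi\<^sub>M {..<k} (\<lambda>_. density lborel std_normal_density)"

text \<open>The joint law of \<open>n\<close> i.i.d. covariates; samples are indexed by \<open>{..<n}\<close>.\<close>

definition covariates :: "nat \<Rightarrow> nat \<Rightarrow> (nat \<Rightarrow> rvec) measure" where
  "covariates n k = Pi\<^sub>M {..<n} (\<lambda>_. std_gaussian k)"

definition response ::
    "nat \<Rightarrow> rvec \<Rightarrow> rvec \<Rightarrow> (nat \<Rightarrow> real) \<Rightarrow> (nat \<Rightarrow> rvec) \<Rightarrow> nat \<Rightarrow> real" where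
  "response k \<beta>1s \<beta>2s z x i = z i * iprod k (x i) \<beta>1s + (1 - z i) * iprod k (x i) \<beta>2s"

definition cluster1 ::
    "nat \<Rightarrow> nat \<Rightarrow> (nat \<Rightarrow> real) \<Rightarrow> (nat \<Rightarrow> rvec) \<Rightarrow> rvec \<Rightarrow> rvec \<Rightarrow> nat set" where
  "cluster1 n k y x \<beta>1 \<beta>2 =
     {i \<in> {..<n}. \<bar>y i - iprod k (x i) \<beta>1\<bar> < \<bar>y i - iprod k (x i) \<beta>2\<bar>}"

definition cluster2 ::
    "nat \<Rightarrow> nat \<Rightarrow> (nat \<Rightarrow> real) \<Rightarrow> (nat \<Rightarrow> rvec) \<Rightarrow> rvec \<Rightarrow> rvec \<Rightarrow> nat set" where
  "cluster2 n k y x \<beta>1 \<beta>2 = {..<n} - cluster1 n k y x \<beta>1 \<beta>2"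

definition least_squares ::
    "nat \<Rightarrow> (nat \<Rightarrow> real) \<Rightarrow> (nat \<Rightarrow> rvec) \<Rightarrow> nat set \<Rightarrow> rvec \<Rightarrow> bool" where
  "least_squares k y x J b \<longleftrightarrow>
     is_arg_min (\<lambda>\<beta>. \<Sum>i\<in>J. (y i - iprod k (x i) \<beta>)\<^sup>2) (\<lambda>\<beta>. \<beta> \<in> vecs k) b"

text \<open>
  One EM iteration is a relation between the old and the new pair, because least squares minimizers
  need not be unique. They always exist.
\<close>

definition EM_step ::
    "nat \<Rightarrow> nat \<Rightarrow> (nat \<Rightarrow> real) \<Rightarrow> (nat \<Rightarrow> rvec) \<Rightarrow> rvec \<Rightarrow> rvec \<Rightarrow> rvec \<Rightarrow> rvec \<Rightarrow> bool" where
  "EM_step n k y x \<beta>1 \<beta>2 b1 b2 \<longleftrightarrow>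
     least_squares k y x (cluster1 n k y x \<beta>1 \<beta>2) b1 \<and>
     least_squares k y x (cluster2 n k y x \<beta>1 \<beta>2) b2"

definition err :: "nat \<Rightarrow> rvec \<Rightarrow> rvec \<Rightarrow> rvec \<Rightarrow> rvec \<Rightarrow> real" where
  "err k \<beta>1s \<beta>2s \<beta>1 \<beta>2 = max (vdist k \<beta>1 \<beta>1s) (vdist k \<beta>2 \<beta>2s)"

end

theory Submission
  imports Defs
begin

text \<open>
  All samples are noiseless, so comparing the loss of the minimizer over \<open>J\<^sub>b\<close> with the loss of the truth gives
  \<open>\<Sum>\<^bsub>correct\<^esub> \<langle>x\<^sub>i, \<beta>\<^sub>b\<^sup>+ - \<beta>\<^sub>b\<^sup>*\<rangle>\<^sup>2 \<le> \<Sum>\<^bsub>wrong\<^esub> \<langle>x\<^sub>i, \<beta>\<^sub>1\<^sup>* - \<beta>\<^sub>2\<^sup>*\<rangle>\<^sup>2\<close>. A sample is misclassified only if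
  \<open>\<bar>\<langle>x\<^sub>i, a\<rangle>\<bar> \<le> \<bar>\<langle>x\<^sub>i, b\<rangle>\<bar>\<close> for fixed \<open>a\<close>, \<open>b\<close> with \<open>\<parallel>b\<parallel> \<le> err\<close> and \<open>\<parallel>a\<parallel> \<ge> \<parallel>\<beta>\<^sub>1\<^sup>* - \<beta>\<^sub>2\<^sup>*\<parallel> / 2\<close>, so the right-hand side
  is at most \<open>4 err\<^sup>2\<close> times the largest eigenvalue of the Gram matrix of the misclassified samples. Since
  \<open>E (1\<^bsub>\<bar>\<langle>x, a\<rangle>\<bar> \<le> \<bar>\<langle>x, b\<rangle>\<bar>\<^esub> exp (\<langle>x, u\<rangle>\<^sup>2 / 32)) = O(\<parallel>b\<parallel> / \<parallel>a\<parallel>)\<close> for unit \<open>u\<close>, a Chernoff bound over a net of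
  \<open>exp (O(k))\<close> directions makes this eigenvalue a small multiple of \<open>n min p\<^sub>1 p\<^sub>2\<close>, while the Gram matrix of
  each true cluster is bounded below by a larger multiple of it.
\<close>

section \<open>Gaussian integrals\<close>

abbreviation stdN :: "real measure" where "stdN \<equiv> density lborel std_normal_density"

lemma prob_space_stdN: "prob_space stdN"
  using prob_space_normal_density[of 1 0] by simp

lemma product_sigma_finite_stdN: "product_sigma_finite (\<lambda>_::nat. stdN)"
  unfolding product_sigma_finite_def
  using prob_space_stdN prob_space_imp_sigma_finite by blast

lemma prob_space_std_gaussian: "prob_space (std_gaussian k)"
  unfolding std_gaussian_def by (intro prob_space_PiM prob_space_stdN)

lemma sets_std_gaussian [measurable_cong]: "sets (std_gaussian k) = sets (Pi\<^sub>M {..<k} (\<lambda>_. borel))"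
  unfolding std_gaussian_def by (intro sets_PiM_cong) auto

lemma space_std_gaussian: "space (std_gaussian k) = vecs k"
  unfolding std_gaussian_def vecs_def by (simp add: space_PiM)

lemma prob_space_covariates: "prob_space (covariates n k)"
  unfolding covariates_def by (intro prob_space_PiM prob_space_std_gaussian)

lemma measurable_iprod [measurable]: "(\<lambda>x. iprod k x u) \<in> borel_measurable (std_gaussian k)"
  unfolding iprod_def by measurable

lemma vnorm_sq: "(vnorm k u)\<^sup>2 = (\<Sum>j<k. (u j)\<^sup>2)"
  unfolding vnorm_def L2_set_def by (simp add: sum_nonneg)

lemma vnorm_nonneg: "vnorm k u \<ge> 0"
  unfolding vnorm_def by (simp add: L2_set_nonneg)

text \<open>The coordinates are independent standard normals, so the linear form is a sum of
  independent centred normals, and their variances \<open>(u j)\<^sup>2\<close> add up to the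
  squared norm.\<close>

lemma distributed_iprod_std_gaussian:
  assumes "vnorm k u > 0"
  shows "distributed (std_gaussian k) lborel (\<lambda>x. iprod k x u) (normal_density 0 (vnorm k u))"
proof -
  interpret prob_space "std_gaussian k" by (rule prob_space_std_gaussian)
  \<comment> \<open>Coordinates with \<open>u j = 0\<close> are dropped: the sum rule for
    independent normals needs every deviation to be positive.\<close>
  define S where "S = {j. j < k \<and> u j \<noteq> 0}"
  have fS: "finite S" and SI: "S \<subseteq> {..<k}" by (auto simp: S_def)
  have "\<exists>j<k. u j \<noteq> 0"
    using assms L2_set_eq_0_iff[of "{..<k}" u] unfolding vnorm_def by force
  hence neS: "S \<noteq> {}" by (auto simp: S_def)
  have distr_coord: "distr (std_gaussian k) borel (\<lambda>x. x j) = stdN" if "j < k" for j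
  proof -
    have "distr (std_gaussian k) stdN (\<lambda>x. x j) = stdN"
      unfolding std_gaussian_def using that
      by (intro distr_PiM_component prob_space_stdN) auto
    moreover have "distr (std_gaussian k) stdN (\<lambda>x. x j) = distr (std_gaussian k) borel (\<lambda>x. x j)"
      by (intro distr_cong) auto
    ultimately show ?thesis by simp
  qed
  have indep: "indep_vars (\<lambda>_. borel) (\<lambda>j x. x j) {..<k}"
    proof (subst indep_vars_iff_distr_eq_PiM')
      show "{..<k} \<noteq> {}" using neS SI by auto
      show "random_variable borel (\<lambda>x. x j)" if "j \<in> {..<k}" for j
        using that by measurable
      have "distr (std_gaussian k) (Pi\<^sub>M {..<k} (\<lambda>_. borel)) (\<lambda>x. \<lambda>j\<in>{..<k}. x j)
          = distr (std_gaussian k) (std_gaussian k) (\<lambda>x. x)"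
        by (intro distr_cong) (auto simp: sets_std_gaussian space_std_gaussian vecs_def PiE_restrict)
      also have "\<dots> = Pi\<^sub>M {..<k} (\<lambda>_. stdN)" by (simp add: distr_id std_gaussian_def)
      also have "\<dots> = Pi\<^sub>M {..<k} (\<lambda>j. distr (std_gaussian k) borel (\<lambda>x. x j))"
        by (intro PiM_cong) (auto simp: distr_coord)
      finally show "distr (std_gaussian k) (Pi\<^sub>M {..<k} (\<lambda>_. borel)) (\<lambda>x. \<lambda>j\<in>{..<k}. x j)
         = Pi\<^sub>M {..<k} (\<lambda>j. distr (std_gaussian k) borel (\<lambda>x. x j))" .
    qed
  have "indep_vars (\<lambda>_. borel) (\<lambda>j x. u j * x j) S"
    by (rule indep_vars_compose2[OF indep_vars_subset[OF indep SI], where Y = "\<lambda>j y. u j * y"]) auto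
  moreover have "distributed (std_gaussian k) lborel (\<lambda>x. u j * x j) (normal_density 0 \<bar>u j\<bar>)"
    if "j \<in> S" for j
  proof -
    have j: "j < k" "u j \<noteq> 0" using that by (auto simp: S_def)
    have "distributed (std_gaussian k) lborel (\<lambda>x. x j) std_normal_density"
      unfolding distributed_def using distr_coord[OF j(1)] j(1)
      by (auto simp: cong: distr_cong)
    from normal_density_affine[OF this, of "u j" 0] show ?thesis using j by simp
  qed
  ultimately have "distributed (std_gaussian k) lborel (\<lambda>x. \<Sum>j\<in>S. u j * x j)
      (normal_density (\<Sum>j\<in>S. 0) (sqrt (\<Sum>j\<in>S. \<bar>u j\<bar>\<^sup>2)))"
    by (intro sum_indep_normal fS neS) (auto simp: S_def)
  moreover have "(\<Sum>j\<in>S. u j * x j) = iprod k x u" for x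
    unfolding iprod_def S_def by (intro sum.mono_neutral_cong_left) (auto simp: mult.commute)
  moreover have "(\<Sum>j\<in>S. \<bar>u j\<bar>\<^sup>2) = (\<Sum>j<k. (u j)\<^sup>2)"
    unfolding S_def by (intro sum.mono_neutral_cong_left) auto
  ultimately show ?thesis by (simp add: vnorm_def L2_set_def)
qed

section \<open>Exponential moments of squared Gaussian linear forms\<close>

text \<open>The exponential factor only changes the variance: the integrand is
  \<open>1 / sqrt r\<close> times the normal density of variance
  \<open>\<sigma>\<^sup>2 / r\<close>, where
  \<open>r = 1 - 2 * \<alpha> * \<sigma>\<^sup>2\<close>.\<close>

lemma nn_integral_exp_sq_normal:
  assumes "\<sigma> > 0" "2 * \<alpha> * \<sigma>\<^sup>2 < 1"
  shows "(\<integral>\<^sup>+x. ennreal (normal_density 0 \<sigma> x) * ennreal (exp (\<alpha> * x\<^sup>2)) \<partial>lborel)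
         = ennreal (1 / sqrt (1 - 2 * \<alpha> * \<sigma>\<^sup>2))"
proof -
  define r where "r = 1 - 2 * \<alpha> * \<sigma>\<^sup>2"
  have r: "r > 0" using assms by (simp add: r_def)
  define \<tau> where "\<tau> = \<sigma> / sqrt r"
  have \<tau>: "\<tau> > 0" "\<tau>\<^sup>2 = \<sigma>\<^sup>2 / r" using assms r by (auto simp: \<tau>_def power_divide)
  have eq: "normal_density 0 \<sigma> x * exp (\<alpha> * x\<^sup>2) = (1 / sqrt r) * normal_density 0 \<tau> x" for x
  proof -
    have "- x\<^sup>2 / (2 * \<sigma>\<^sup>2) + \<alpha> * x\<^sup>2 = - x\<^sup>2 / (2 * \<tau>\<^sup>2)"
      using assms r by (simp add: \<tau> r_def field_simps)
    moreover have "sqrt (2 * pi * \<tau>\<^sup>2) = sqrt (2 * pi * \<sigma>\<^sup>2) / sqrt r"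
      unfolding \<tau> by (simp add: real_sqrt_divide real_sqrt_mult)
    ultimately show ?thesis
      using r by (simp add: normal_density_def flip: exp_add)
  qed
  have "(\<integral>\<^sup>+x. ennreal (normal_density 0 \<sigma> x) * ennreal (exp (\<alpha> * x\<^sup>2)) \<partial>lborel)
      = (\<integral>\<^sup>+x. ennreal (1 / sqrt r) * ennreal (normal_density 0 \<tau> x) \<partial>lborel)"
    using r by (intro nn_integral_cong) (simp add: eq flip: ennreal_mult)
  also have "\<dots> = ennreal (1 / sqrt r) * (\<integral>\<^sup>+x. ennreal (normal_density 0 \<tau> x) \<partial>lborel)"
    by (intro nn_integral_cmult) auto
  also have "(\<integral>\<^sup>+x. ennreal (normal_density 0 \<tau> x) \<partial>lborel) = 1"
    using prob_space.emeasure_space_1[OF prob_space_normal_density[OF \<tau>(1), of 0]]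
    by (simp add: emeasure_density)
  finally show ?thesis by (simp add: r_def)
qed

lemma nn_integral_exp_iprod_sq:
  assumes "vnorm k u > 0" "2 * \<alpha> * (vnorm k u)\<^sup>2 < 1"
  shows "(\<integral>\<^sup>+x. ennreal (exp (\<alpha> * (iprod k x u)\<^sup>2)) \<partial>std_gaussian k)
         = ennreal (1 / sqrt (1 - 2 * \<alpha> * (vnorm k u)\<^sup>2))"
  using distributed_nn_integral[OF distributed_iprod_std_gaussian[OF assms(1)],
      of "\<lambda>t. ennreal (exp (\<alpha> * t\<^sup>2))"] nn_integral_exp_sq_normal[OF assms]
  by simp

lemma iprod_eq_0: "vnorm k u = 0 \<Longrightarrow> iprod k x u = 0"
  unfolding vnorm_def iprod_def by (simp add: L2_set_eq_0_iff)

lemma nn_integral_exp_iprod_sq_le_2: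
  assumes "vnorm k u \<le> 1"
  shows "(\<integral>\<^sup>+x. ennreal (exp ((iprod k x u)\<^sup>2 / 8)) \<partial>std_gaussian k) \<le> 2"
proof (cases "vnorm k u = 0")
  case True
  interpret prob_space "std_gaussian k" by (rule prob_space_std_gaussian)
  show ?thesis using iprod_eq_0[OF True] by (simp add: emeasure_space_1)
next
  case False
  hence pos: "vnorm k u > 0" using vnorm_nonneg[of k u] by simp
  have le: "(vnorm k u)\<^sup>2 \<le> 1" using assms pos by (simp add: power_le_one)
  \<comment> \<open>The quantity under the root is at least 3/4; the weaker 1/4 has a rational root
    and gives the bound 2.\<close>
  have "sqrt (1/4) \<le> sqrt (1 - 2 * (1/8) * (vnorm k u)\<^sup>2)"
    using le by (intro real_sqrt_le_mono) simp
  hence "1 / 2 \<le> sqrt (1 - 2 * (1/8) * (vnorm k u)\<^sup>2)" by (simp add: real_sqrt_divide)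
  hence "1 / sqrt (1 - 2 * (1/8) * (vnorm k u)\<^sup>2) \<le> 1 / (1 / 2)"
    using le by (intro divide_left_mono) auto
  hence "ennreal (1 / sqrt (1 - 2 * (1/8) * (vnorm k u)\<^sup>2)) \<le> ennreal 2"
    by (intro ennreal_leI) simp
  thus ?thesis using nn_integral_exp_iprod_sq[OF pos, of "1/8"] le by simp
qed

lemma nn_integral_exp_neg_iprod_sq_le:
  assumes "vnorm k u \<ge> 1 / 4"
  shows "(\<integral>\<^sup>+x. ennreal (exp (- 64 * (iprod k x u)\<^sup>2)) \<partial>std_gaussian k) \<le> ennreal (exp (- 1))"
proof -
  have pos: "vnorm k u > 0" using assms by simp
  \<comment> \<open>The factor 64 makes the root at least \<open>sqrt (1 + 128 / 16) = 3\<close>,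
    and \<open>exp 1 \<le> 3\<close>.\<close>
  have "(1/4)\<^sup>2 \<le> (vnorm k u)\<^sup>2" using assms by (intro power_mono) auto
  hence "sqrt 9 \<le> sqrt (1 + 128 * (vnorm k u)\<^sup>2)"
    by (intro real_sqrt_le_mono) (simp add: power2_eq_square)
  hence "3 \<le> sqrt (1 + 128 * (vnorm k u)\<^sup>2)" by simp
  hence "1 / sqrt (1 + 128 * (vnorm k u)\<^sup>2) \<le> 1 / 3" by (intro divide_left_mono) (auto intro!: mult_pos_pos add_pos_nonneg)
  also have "\<dots> \<le> 1 / exp 1" using exp_le by (intro divide_left_mono) auto
  finally have "ennreal (1 / sqrt (1 + 128 * (vnorm k u)\<^sup>2)) \<le> ennreal (exp (- 1))"
    by (intro ennreal_leI) (simp add: exp_minus field_simps)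
  moreover have "128 * (vnorm k u)\<^sup>2 > - 1" by (rule less_le_trans[of _ 0]) auto
  ultimately show ?thesis using nn_integral_exp_iprod_sq[OF pos, of "-64"] by simp
qed

section \<open>Translation of Gaussian measures\<close>

lemma nn_integral_stdN_shift:
  assumes [measurable]: "f \<in> borel_measurable borel"
  shows "(\<integral>\<^sup>+y. f y \<partial>stdN) = (\<integral>\<^sup>+y. f (y + s) * ennreal (exp (- (s * y + s\<^sup>2 / 2))) \<partial>stdN)"
proof -
  have "std_normal_density (s + y) = std_normal_density y * exp (- (s * y + s\<^sup>2 / 2))" for y
    by (simp add: std_normal_density_def power2_eq_square field_simps flip: exp_add)
  hence eq: "ennreal (std_normal_density (s + y)) * f (s + y)
      = ennreal (std_normal_density y) * (f (y + s) * ennreal (exp (- (s * y + s\<^sup>2 / 2))))" for y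
    by (simp add: ennreal_mult mult_ac add.commute[of y s])
  have "(\<integral>\<^sup>+y. f y \<partial>stdN) = (\<integral>\<^sup>+y. ennreal (std_normal_density y) * f y \<partial>lborel)"
    by (intro nn_integral_density) auto
  also have "\<dots> = (\<integral>\<^sup>+y. ennreal (std_normal_density (s + y)) * f (s + y) \<partial>lborel)"
    by (subst nn_integral_real_affine[of _ 1 s]) auto
  also have "\<dots> = (\<integral>\<^sup>+y. f (y + s) * ennreal (exp (- (s * y + s\<^sup>2 / 2))) \<partial>stdN)"
    unfolding eq by (intro nn_integral_density[symmetric]) auto
  finally show ?thesis .
qed

text \<open>Induction on the index set: the new coordinate is integrated out and shifted by the
  one-dimensional formula, and the induction hypothesis is applied to the resulting function
  \<open>g\<close> of the remaining coordinates. The restriction to \<open>I\<close> keeps the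
  shifted vector extensional.\<close>

lemma nn_integral_PiM_stdN_Cameron_Martin:
  assumes "finite I" "f \<in> borel_measurable (Pi\<^sub>M I (\<lambda>_. borel))"
  shows "(\<integral>\<^sup>+x. f x \<partial>Pi\<^sub>M I (\<lambda>_::nat. stdN))
       = (\<integral>\<^sup>+x. f (\<lambda>i\<in>I. x i + a i) * ennreal (exp (- (\<Sum>i\<in>I. a i * x i + (a i)\<^sup>2 / 2)))
            \<partial>Pi\<^sub>M I (\<lambda>_. stdN))"
  using assms
proof (induction I arbitrary: f)
  case empty
  have "product_sigma_finite (\<lambda>_::nat. stdN)" by (rule product_sigma_finite_stdN)
  thus ?case by (simp add: PiM_empty nn_integral_count_space_finite)
next
  case (insert i I)
  interpret product_sigma_finite "\<lambda>_::nat. stdN" by (rule product_sigma_finite_stdN)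
  have sN: "sets (Pi\<^sub>M J (\<lambda>_::nat. stdN)) = sets (Pi\<^sub>M J (\<lambda>_. borel))" for J
    by (intro sets_PiM_cong) auto
  note [measurable_cong] = sN
  note [measurable] = insert.prems
  have upd [measurable]: "(\<lambda>(x, y). x(i := y)) \<in> measurable (Pi\<^sub>M I (\<lambda>_. borel) \<Otimes>\<^sub>M borel)
     (Pi\<^sub>M (insert i I) (\<lambda>_. borel))"
    using measurable_add_dim[of i I "\<lambda>_. borel"] by simp
  let ?e = "\<lambda>c t. ennreal (exp (- (c * t + c\<^sup>2 / 2)))"
  define g where "g x = (\<integral>\<^sup>+y. f (x(i := y + a i)) * ?e (a i) y \<partial>stdN)" for x
  have f2: "(\<lambda>(x, y). f (x(i := y + a i)) * ?e (a i) y) \<in> borel_measurable (Pi\<^sub>M I (\<lambda>_. borel) \<Otimes>\<^sub>M stdN)"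
  proof -
    have "(\<lambda>(x, y). x(i := y + a i)) \<in> measurable (Pi\<^sub>M I (\<lambda>_. borel) \<Otimes>\<^sub>M stdN)
     (Pi\<^sub>M (insert i I) (\<lambda>_. borel))"
      using measurable_compose[OF _ upd, of "\<lambda>(x, y). (x, y + a i)"] by (simp add: case_prod_beta')
    thus ?thesis using insert.prems by (simp add: case_prod_beta') measurable
  qed
  have g [measurable]: "g \<in> borel_measurable (Pi\<^sub>M I (\<lambda>_. borel))"
    unfolding g_def by (rule sigma_finite_measure.borel_measurable_nn_integral[OF sigma_finite_measures]) (use f2 in \<open>simp add: case_prod_beta'\<close>)
  have "(\<integral>\<^sup>+x. f x \<partial>Pi\<^sub>M (insert i I) (\<lambda>_. stdN))
      = (\<integral>\<^sup>+x. (\<integral>\<^sup>+y. f (x(i := y)) \<partial>stdN) \<partial>Pi\<^sub>M I (\<lambda>_. stdN))"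
    using insert by (intro product_nn_integral_insert) auto
  also have "\<dots> = (\<integral>\<^sup>+x. g x \<partial>Pi\<^sub>M I (\<lambda>_. stdN))"
    unfolding g_def
  proof (rule nn_integral_cong, rule nn_integral_stdN_shift)
    fix x assume "x \<in> space (Pi\<^sub>M I (\<lambda>_. stdN))"
    hence x: "x \<in> space (Pi\<^sub>M I (\<lambda>_. borel))" by (simp add: space_PiM)
    have "(\<lambda>y. x(i := y)) \<in> measurable borel (Pi\<^sub>M (insert i I) (\<lambda>_. borel))"
      using measurable_compose[OF measurable_Pair1'[OF x] upd] by simp
    thus "(\<lambda>y. f (x(i := y))) \<in> borel_measurable borel"
      using insert.prems measurable_compose by blast
  qed
  also have "\<dots> = (\<integral>\<^sup>+x. g (\<lambda>j\<in>I. x j + a j) *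
      ennreal (exp (- (\<Sum>j\<in>I. a j * x j + (a j)\<^sup>2 / 2))) \<partial>Pi\<^sub>M I (\<lambda>_. stdN))"
    by (rule insert.IH[OF g])
  also have "\<dots> = (\<integral>\<^sup>+x. (\<integral>\<^sup>+y. f (\<lambda>j\<in>insert i I. (x(i := y)) j + a j) *
      ennreal (exp (- (\<Sum>j\<in>insert i I. a j * (x(i := y)) j + (a j)\<^sup>2 / 2))) \<partial>stdN) \<partial>Pi\<^sub>M I (\<lambda>_. stdN))"
  proof (intro nn_integral_cong)
    fix x assume x: "x \<in> space (Pi\<^sub>M I (\<lambda>_. stdN))"
    let ?w = "ennreal (exp (- (\<Sum>j\<in>I. a j * x j + (a j)\<^sup>2 / 2)))"
    let ?x = "\<lambda>j\<in>I. x j + a j"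
    have x': "?x \<in> space (Pi\<^sub>M I (\<lambda>_. borel))" by (simp add: space_PiM)
    have m: "(\<lambda>y. f (?x(i := y + a i)) * ?e (a i) y) \<in> borel_measurable stdN"
      using measurable_compose[OF measurable_Pair1'[OF x'] f2] by simp
    have "g ?x * ?w = (\<integral>\<^sup>+y. f (?x(i := y + a i)) * ?e (a i) y * ?w \<partial>stdN)"
      unfolding g_def by (rule nn_integral_multc[symmetric, OF m])
    also have "\<dots> = (\<integral>\<^sup>+y. f (\<lambda>j\<in>insert i I. (x(i := y)) j + a j) *
      ennreal (exp (- (\<Sum>j\<in>insert i I. a j * (x(i := y)) j + (a j)\<^sup>2 / 2))) \<partial>stdN)"
    proof (intro nn_integral_cong)
      fix y
      have 1: "?x(i := y + a i) = (\<lambda>j\<in>insert i I. (x(i := y)) j + a j)"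
        using insert.hyps by (auto simp: fun_eq_iff)
      have "(\<Sum>j\<in>I. a j * (x(i := y)) j + (a j)\<^sup>2 / 2) = (\<Sum>j\<in>I. a j * x j + (a j)\<^sup>2 / 2)"
        using insert.hyps by (intro sum.cong) auto
      hence 2: "(\<Sum>j\<in>insert i I. a j * (x(i := y)) j + (a j)\<^sup>2 / 2)
          = (a i * y + (a i)\<^sup>2 / 2) + (\<Sum>j\<in>I. a j * x j + (a j)\<^sup>2 / 2)"
        using insert.hyps by simp
      show "f (?x(i := y + a i)) * ?e (a i) y * ?w = f (\<lambda>j\<in>insert i I. (x(i := y)) j + a j) *
          ennreal (exp (- (\<Sum>j\<in>insert i I. a j * (x(i := y)) j + (a j)\<^sup>2 / 2)))"
        unfolding 1 2 by (simp add: mult.assoc flip: ennreal_mult exp_add)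
    qed
    finally show "g ?x * ?w = \<dots>" .
  qed
  also have "\<dots> = (\<integral>\<^sup>+x. f (\<lambda>j\<in>insert i I. x j + a j) *
      ennreal (exp (- (\<Sum>j\<in>insert i I. a j * x j + (a j)\<^sup>2 / 2))) \<partial>Pi\<^sub>M (insert i I) (\<lambda>_. stdN))"
    using insert.hyps by (intro product_nn_integral_insert[symmetric]) auto
  finally show ?case .
qed

section \<open>Inner products and the slab estimate\<close>

lemma iprod_abs_le: "\<bar>iprod k u v\<bar> \<le> vnorm k u * vnorm k v"
proof -
  have "\<bar>iprod k u v\<bar> \<le> (\<Sum>j<k. \<bar>u j\<bar> * \<bar>v j\<bar>)"
    unfolding iprod_def by (rule order.trans[OF sum_abs]) (simp add: abs_mult)
  also have "\<dots> \<le> vnorm k u * vnorm k v"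
    unfolding vnorm_def by (rule L2_set_mult_ineq)
  finally show ?thesis .
qed

lemma vnorm_cmult: "vnorm k (\<lambda>j. c * u j) = \<bar>c\<bar> * vnorm k u"
  unfolding vnorm_def L2_set_def
  by (simp add: power_mult_distrib real_sqrt_mult flip: sum_distrib_left)

lemma iprod_cmult_right: "iprod k x (\<lambda>j. c * u j) = c * iprod k x u"
  unfolding iprod_def by (simp add: sum_distrib_left mult_ac)

lemma iprod_diff_right: "iprod k x (\<lambda>j. u j - v j) = iprod k x u - iprod k x v"
  unfolding iprod_def by (simp add: algebra_simps sum_subtractf)

text \<open>
  Shifting by \<open>s a\<close> (Cameron--Martin) and averaging over \<open>s \<in> [0, 1]\<close> smooths out the event: for fixed \<open>x\<close>
  the shifted event is an interval of length \<open>O(\<epsilon>)\<close> in \<open>s\<close>. This yields a bound linear in \<open>\<epsilon>\<close>, where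
  Cauchy--Schwarz would only give \<open>sqrt \<epsilon>\<close>.
\<close>

lemma nn_integral_exp_slab_unit:
  assumes a: "vnorm k a = 1" and b: "vnorm k b \<le> \<epsilon>" and \<epsilon>: "0 < \<epsilon>" "\<epsilon> \<le> 1"
    and u: "vnorm k u \<le> 1"
  shows "(\<integral>\<^sup>+x. (if \<bar>iprod k x a\<bar> \<le> \<bar>iprod k x b\<bar> then ennreal (exp ((iprod k x u)\<^sup>2 / 32)) else 0)
            \<partial>std_gaussian k) \<le> ennreal (4 * exp 18 * \<epsilon>)"
proof -
  interpret prob_space "std_gaussian k" by (rule prob_space_std_gaussian)
  interpret L: pair_sigma_finite lborel "std_gaussian k"
    by (intro pair_sigma_finite.intro sigma_finite_lborel sigma_finite_measure_axioms)
  let ?g = "\<lambda>x. iprod k x a" and ?h = "\<lambda>x. iprod k x b" and ?X = "\<lambda>x. iprod k x u"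
  define t where "t = iprod k a b"
  define c where "c = iprod k a u"
  have t: "\<bar>t\<bar> \<le> \<epsilon>" using iprod_abs_le[of k a b] a b by (simp add: t_def)
  have c: "\<bar>c\<bar> \<le> 1" using iprod_abs_le[of k a u] a u by (simp add: c_def)
  define F where "F x = (if \<bar>?g x\<bar> \<le> \<bar>?h x\<bar> then ennreal (exp ((?X x)\<^sup>2 / 32)) else 0)" for x
  have Fm: "F \<in> borel_measurable (std_gaussian k)" unfolding F_def by measurable
  \<comment> \<open>\<open>G s\<close> is the integrand after a shift by \<open>s * a\<close>: since
    \<open>a\<close> is a unit vector, the forms in \<open>a\<close>, \<open>b\<close>,
    \<open>u\<close> move by \<open>s\<close>, \<open>s * t\<close>, \<open>s * c\<close>.\<close>
  define G where "G s x = (if \<bar>?g x + s\<bar> \<le> \<bar>?h x + s * t\<bar>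
      then ennreal (exp ((?X x + s * c)\<^sup>2 / 32)) else 0) * ennreal (exp (- (s * ?g x + s\<^sup>2 / 2)))" for s x
  have shift: "integral\<^sup>N (std_gaussian k) F = (\<integral>\<^sup>+x. G s x \<partial>std_gaussian k)" for s
  proof -
    have ip: "iprod k (\<lambda>i\<in>{..<k}. x i + s * a i) v = iprod k x v + s * iprod k a v" for x v
      unfolding iprod_def by (simp add: distrib_right sum.distrib sum_distrib_left mult.assoc)
    have aa: "iprod k a a = 1"
      using a vnorm_sq[of k a] by (simp add: iprod_def power2_eq_square)
    have sm: "(\<Sum>i<k. s * a i * x i + (s * a i)\<^sup>2 / 2) = s * ?g x + s\<^sup>2 / 2" for x
    proof -
      have "(\<Sum>i<k. s * a i * x i + (s * a i)\<^sup>2 / 2) = s * ?g x + s\<^sup>2 / 2 * iprod k a a"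
        unfolding iprod_def
        by (simp add: sum.distrib sum_distrib_left power2_eq_square mult_ac sum_divide_distrib)
      thus ?thesis by (simp add: aa)
    qed
    have "integral\<^sup>N (std_gaussian k) F = (\<integral>\<^sup>+x. F (\<lambda>i\<in>{..<k}. x i + s * a i) *
        ennreal (exp (- (\<Sum>i<k. s * a i * x i + (s * a i)\<^sup>2 / 2))) \<partial>std_gaussian k)"
      unfolding std_gaussian_def
      by (rule nn_integral_PiM_stdN_Cameron_Martin) (use Fm sets_std_gaussian in \<open>auto cong: measurable_cong_sets\<close>)
    also have "\<dots> = (\<integral>\<^sup>+x. G s x \<partial>std_gaussian k)"
      by (intro nn_integral_cong) (simp only: F_def G_def ip sm aa t_def c_def mult_1_right)
    finally show ?thesis .
  qed
  \<comment> \<open>For \<open>s\<close> in the unit interval,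
    \<open>\<bar>s * t\<bar> \<le> \<epsilon>\<close>, so \<open>r x\<close> bounds the right-hand
    side of the shifted event; it is the half-length of an interval around \<open>- ?g x\<close>
    that contains all admissible \<open>s\<close>.\<close>
  define r where "r x = \<bar>?h x\<bar> + \<epsilon>" for x
  define K where "K x = exp ((?X x)\<^sup>2 / 16 + r x + 9 / 16)" for x
  have r0: "r x \<ge> 0" for x using \<epsilon> by (simp add: r_def)
  have rm [measurable]: "r \<in> borel_measurable (std_gaussian k)" unfolding r_def by measurable
  have Km [measurable]: "K \<in> borel_measurable (std_gaussian k)" unfolding K_def by measurable
  \<comment> \<open>On the event the weight exponent is
    \<open>- s * (?g x + s) + s\<^sup>2 / 2 \<le> r x + 1 / 2\<close>, and expanding the square
    costs another 1/16; this is the 9/16 in \<open>K\<close>.\<close>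
  have bound: "indicator {0..1} s * G s x \<le> ennreal (K x) * indicator {- ?g x - r x .. - ?g x + r x} s" for s x
  proof (cases "s \<in> {0..1} \<and> \<bar>?g x + s\<bar> \<le> \<bar>?h x + s * t\<bar>")
    case True
    hence s: "0 \<le> s" "s \<le> 1" by auto
    have "\<bar>s * t\<bar> \<le> 1 * \<epsilon>" unfolding abs_mult using s t by (intro mult_mono) auto
    hence gr: "\<bar>?g x + s\<bar> \<le> r x" using True unfolding r_def by linarith
    hence ind: "s \<in> {- ?g x - r x .. - ?g x + r x}" by auto
    have "\<bar>s * c\<bar> \<le> 1 * 1" unfolding abs_mult using s c by (intro mult_mono) auto
    hence "(s * c)\<^sup>2 \<le> 1" by (simp add: abs_square_le_1)
    moreover have "(?X x + s * c)\<^sup>2 \<le> 2 * (?X x)\<^sup>2 + 2 * (s * c)\<^sup>2"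
      using zero_le_power2[of "?X x - s * c"] by (simp add: power2_eq_square algebra_simps)
    ultimately have 1: "(?X x + s * c)\<^sup>2 / 32 \<le> (?X x)\<^sup>2 / 16 + 1 / 16" by simp
    have "s * ?g x + s\<^sup>2 / 2 = s * (?g x + s) - s\<^sup>2 / 2" by (simp add: power2_eq_square algebra_simps)
    moreover have "\<bar>s * (?g x + s)\<bar> \<le> 1 * r x" unfolding abs_mult using s gr by (intro mult_mono) auto
    moreover have "s\<^sup>2 \<le> 1" using s by (simp add: power_le_one)
    ultimately have 2: "- (s * ?g x + s\<^sup>2 / 2) \<le> r x + 1 / 2" by linarith
    have "exp ((?X x + s * c)\<^sup>2 / 32) * exp (- (s * ?g x + s\<^sup>2 / 2)) \<le> K x"
      unfolding K_def exp_add[symmetric] exp_le_cancel_iff using 1 2 by linarith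
    thus ?thesis using True ind unfolding G_def
      by (simp add: ennreal_leI flip: ennreal_mult)
  next
    case False
    thus ?thesis by (auto simp: G_def indicator_def)
  qed
  \<comment> \<open>The unit interval has length 1, so averaging the constant over \<open>s\<close>
    changes nothing; each copy can then be shifted by its own \<open>s\<close>.\<close>
  have "integral\<^sup>N (std_gaussian k) F = (\<integral>\<^sup>+s. indicator {0..1::real} s * integral\<^sup>N (std_gaussian k) F \<partial>lborel)"
    by (simp add: nn_integral_multc)
  also have "\<dots> = (\<integral>\<^sup>+s. (\<integral>\<^sup>+x. indicator {0..1} s * G s x \<partial>std_gaussian k) \<partial>lborel)"
  proof (intro nn_integral_cong)
    fix s :: real
    have "G s \<in> borel_measurable (std_gaussian k)" unfolding G_def by measurable
    thus "indicator {0..1} s * integral\<^sup>N (std_gaussian k) F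
       = (\<integral>\<^sup>+x. indicator {0..1} s * G s x \<partial>std_gaussian k)"
      by (simp add: nn_integral_cmult shift[of s])
  qed
  also have "\<dots> = (\<integral>\<^sup>+x. (\<integral>\<^sup>+s. indicator {0..1} s * G s x \<partial>lborel) \<partial>std_gaussian k)"
    by (rule L.Fubini'[symmetric]) (unfold G_def, measurable)
  also have "\<dots> \<le> (\<integral>\<^sup>+x. ennreal (2 * r x * K x) \<partial>std_gaussian k)"
  proof (intro nn_integral_mono)
    fix x
    have "(\<integral>\<^sup>+s. indicator {0..1} s * G s x \<partial>lborel)
       \<le> (\<integral>\<^sup>+s. ennreal (K x) * indicator {- ?g x - r x .. - ?g x + r x} s \<partial>lborel)"
      by (intro nn_integral_mono bound)
    also have "\<dots> = ennreal (K x) * ennreal (2 * r x)"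
      using r0[of x] by (simp add: nn_integral_cmult_indicator)
    also have "\<dots> = ennreal (2 * r x * K x)"
      using r0[of x] by (simp add: K_def mult.commute flip: ennreal_mult)
    finally show "(\<integral>\<^sup>+s. indicator {0..1} s * G s x \<partial>lborel) \<le> ennreal (2 * r x * K x)" .
  qed
  \<comment> \<open>With \<open>y = \<bar>?h x\<bar> / \<epsilon>\<close> one has
    \<open>r x = \<epsilon> * (1 + y)\<close>, which yields the linear factor
    \<open>\<epsilon>\<close>. The remaining \<open>exp (2 * y)\<close> is absorbed by
    \<open>2 * y \<le> y\<^sup>2 / 16 + 16\<close>, and 16 + 1 + 9/16 is below 18. Here
    \<open>y\<close> is the absolute value of the form in \<open>b\<close> divided by
    \<open>\<epsilon>\<close>, a vector of norm at most 1.\<close>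
  also have "\<dots> \<le> (\<integral>\<^sup>+x. ennreal (exp 18 * \<epsilon>) * (ennreal (exp ((?X x)\<^sup>2 / 8)) +
      ennreal (exp ((iprod k x (\<lambda>j. (1 / \<epsilon>) * b j))\<^sup>2 / 8))) \<partial>std_gaussian k)"
  proof (intro nn_integral_mono)
    fix x
    define y where "y = \<bar>?h x / \<epsilon>\<bar>"
    have y0: "y \<ge> 0" by (simp add: y_def)
    have req: "r x = \<epsilon> * (1 + y)" using \<epsilon> by (simp add: r_def y_def field_simps)
    have ey: "1 + y \<le> exp y" by (rule exp_ge_add_one_self)
    have "r x \<le> 1 * (1 + y)" unfolding req using \<epsilon> y0 by (intro mult_right_mono) auto
    moreover have "2 * y \<le> y\<^sup>2 / 16 + 16"
      using zero_le_power2[of "y - 16"] by (simp add: power2_eq_square algebra_simps)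
    ultimately have "y + ((?X x)\<^sup>2 / 16 + r x + 9 / 16) \<le> 18 + ((?X x)\<^sup>2 / 16 + y\<^sup>2 / 16)" by simp
    hence 1: "exp y * K x \<le> exp 18 * (exp ((?X x)\<^sup>2 / 16) * exp (y\<^sup>2 / 16))"
      unfolding K_def exp_add[symmetric] exp_le_cancel_iff .
    have 2: "2 * (exp ((?X x)\<^sup>2 / 16) * exp (y\<^sup>2 / 16)) \<le> exp ((?X x)\<^sup>2 / 8) + exp (y\<^sup>2 / 8)"
    proof -
      have "exp (z / 8) = (exp (z / 16))\<^sup>2" for z :: real by (simp add: power2_eq_square flip: exp_add)
      thus ?thesis
        using zero_le_power2[of "exp ((?X x)\<^sup>2 / 16) - exp (y\<^sup>2 / 16)"]
        by (simp add: power2_eq_square algebra_simps)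
    qed
    have "2 * r x * K x \<le> 2 * (\<epsilon> * exp y) * K x"
      unfolding req using \<epsilon> ey by (intro mult_right_mono mult_left_mono) (auto simp: K_def)
    also have "\<dots> = 2 * \<epsilon> * (exp y * K x)" by simp
    also have "\<dots> \<le> 2 * \<epsilon> * (exp 18 * (exp ((?X x)\<^sup>2 / 16) * exp (y\<^sup>2 / 16)))"
      using \<epsilon> 1 by (intro mult_left_mono) auto
    also have "\<dots> = exp 18 * \<epsilon> * (2 * (exp ((?X x)\<^sup>2 / 16) * exp (y\<^sup>2 / 16)))" by simp
    also have "\<dots> \<le> exp 18 * \<epsilon> * (exp ((?X x)\<^sup>2 / 8) + exp (y\<^sup>2 / 8))"
      using \<epsilon> 2 by (intro mult_left_mono) auto
    also have "y\<^sup>2 = (iprod k x (\<lambda>j. (1 / \<epsilon>) * b j))\<^sup>2"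
      unfolding iprod_cmult_right by (simp add: y_def power_divide)
    finally have "ennreal (2 * r x * K x) \<le> ennreal (exp 18 * \<epsilon> * (exp ((?X x)\<^sup>2 / 8) +
        exp ((iprod k x (\<lambda>j. (1 / \<epsilon>) * b j))\<^sup>2 / 8)))" by (rule ennreal_leI)
    also have "\<dots> = ennreal (exp 18 * \<epsilon>) * (ennreal (exp ((?X x)\<^sup>2 / 8)) +
      ennreal (exp ((iprod k x (\<lambda>j. (1 / \<epsilon>) * b j))\<^sup>2 / 8)))"
      using \<epsilon> by (simp add: ennreal_mult)
    finally show "ennreal (2 * r x * K x) \<le> \<dots>" .
  qed
  also have "\<dots> = ennreal (exp 18 * \<epsilon>) * ((\<integral>\<^sup>+x. ennreal (exp ((?X x)\<^sup>2 / 8)) \<partial>std_gaussian k) +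
      (\<integral>\<^sup>+x. ennreal (exp ((iprod k x (\<lambda>j. (1 / \<epsilon>) * b j))\<^sup>2 / 8)) \<partial>std_gaussian k))"
    by (subst nn_integral_cmult, measurable) (subst nn_integral_add, auto)
  also have "\<dots> \<le> ennreal (exp 18 * \<epsilon>) * (2 + 2)"
  proof (intro mult_left_mono add_mono nn_integral_exp_iprod_sq_le_2 u)
    show "vnorm k (\<lambda>j. (1 / \<epsilon>) * b j) \<le> 1"
      unfolding vnorm_cmult using b \<epsilon> by (simp add: field_simps)
  qed auto
  also have "(2 + 2 :: ennreal) = ennreal 4" by simp
  also have "ennreal (exp 18 * \<epsilon>) * ennreal 4 = ennreal (4 * exp 18 * \<epsilon>)"
    using \<epsilon> by (subst ennreal_mult[symmetric]) (auto simp: mult_ac)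
  finally show ?thesis by (simp add: F_def[abs_def])
qed

text \<open>The slab event is invariant under scaling \<open>a\<close> and \<open>b\<close>
  together, which reduces to a unit vector. Off the slab the integrand is 1, so the integral is at
  most one plus the slab part, and \<open>1 + t \<le> exp t\<close> gives the form needed for
  Chernoff bounds.\<close>

lemma nn_integral_exp_slab:
  assumes a: "vnorm k a > 0" and b: "vnorm k b \<le> \<epsilon> * vnorm k a" and \<epsilon>: "0 < \<epsilon>" "\<epsilon> \<le> 1"
    and u: "vnorm k u \<le> 1"
  shows "(\<integral>\<^sup>+x. ennreal (exp (if \<bar>iprod k x a\<bar> \<le> \<bar>iprod k x b\<bar> then (iprod k x u)\<^sup>2 / 32 else 0))
            \<partial>std_gaussian k) \<le> ennreal (exp (4 * exp 18 * \<epsilon>))"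
proof -
  interpret prob_space "std_gaussian k" by (rule prob_space_std_gaussian)
  define \<alpha> where "\<alpha> = 1 / vnorm k a"
  have \<alpha>: "\<alpha> > 0" using a by (simp add: \<alpha>_def)
  let ?a = "\<lambda>j. \<alpha> * a j" and ?b = "\<lambda>j. \<alpha> * b j"
  have "vnorm k ?a = 1" "vnorm k ?b \<le> \<epsilon>"
    unfolding vnorm_cmult using a b by (auto simp: \<alpha>_def field_simps)
  note slab = nn_integral_exp_slab_unit[OF this \<epsilon> u]
  have iff: "\<bar>iprod k x ?a\<bar> \<le> \<bar>iprod k x ?b\<bar> \<longleftrightarrow> \<bar>iprod k x a\<bar> \<le> \<bar>iprod k x b\<bar>" for x
    unfolding iprod_cmult_right using \<alpha> by (simp add: abs_mult)
  have "(\<integral>\<^sup>+x. ennreal (exp (if \<bar>iprod k x a\<bar> \<le> \<bar>iprod k x b\<bar> then (iprod k x u)\<^sup>2 / 32 else 0))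
            \<partial>std_gaussian k) \<le> (\<integral>\<^sup>+x. 1 + (if \<bar>iprod k x a\<bar> \<le> \<bar>iprod k x b\<bar>
            then ennreal (exp ((iprod k x u)\<^sup>2 / 32)) else 0) \<partial>std_gaussian k)"
    by (intro nn_integral_mono) auto
  also have "\<dots> = 1 + (\<integral>\<^sup>+x. (if \<bar>iprod k x a\<bar> \<le> \<bar>iprod k x b\<bar>
            then ennreal (exp ((iprod k x u)\<^sup>2 / 32)) else 0) \<partial>std_gaussian k)"
    by (subst nn_integral_add) (auto simp: emeasure_space_1)
  also have "\<dots> \<le> 1 + ennreal (4 * exp 18 * \<epsilon>)"
    using slab unfolding iff by (intro add_left_mono)
  also have "\<dots> = ennreal (1 + 4 * exp 18 * \<epsilon>)" using \<epsilon> by simp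
  also have "\<dots> \<le> ennreal (exp (4 * exp 18 * \<epsilon>))"
    by (intro ennreal_leI exp_ge_add_one_self)
  finally show ?thesis .
qed

section \<open>Chernoff bounds over independent covariates\<close>

lemma measurable_sum_covariates:
  fixes \<phi> :: "rvec \<Rightarrow> real"
  assumes "I \<subseteq> {..<n}" "\<phi> \<in> borel_measurable (std_gaussian k)"
  shows "(\<lambda>x. \<Sum>i\<in>I. \<phi> (x i)) \<in> borel_measurable (covariates n k)"
proof (rule borel_measurable_sum)
  fix i assume "i \<in> I"
  hence "i \<in> {..<n}" using assms by blast
  thus "(\<lambda>x. \<phi> (x i)) \<in> borel_measurable (covariates n k)"
    unfolding covariates_def using assms(2)
    by (rule measurable_compose[OF measurable_component_singleton[where M = "\<lambda>_. std_gaussian k"]])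
qed

text \<open>Exponential Markov inequality at parameter 1, with the moment generating function
  factored by independence. Both \<open>\<kappa>\<close> and \<open>T\<close> may be negative, so a
  nonpositive \<open>\<phi>\<close> yields lower-tail bounds as well.\<close>

lemma covariates_chernoff:
  assumes I: "I \<subseteq> {..<n}" and \<phi> [measurable]: "\<phi> \<in> borel_measurable (std_gaussian k)"
    and mgf: "(\<integral>\<^sup>+y. ennreal (exp (\<phi> y)) \<partial>std_gaussian k) \<le> ennreal (exp \<kappa>)"
  shows "measure (covariates n k) {x \<in> space (covariates n k). T \<le> (\<Sum>i\<in>I. \<phi> (x i))}
       \<le> exp (\<kappa> * real (card I) - T)"
proof -
  interpret C: prob_space "covariates n k" by (rule prob_space_covariates)
  interpret G: prob_space "std_gaussian k" by (rule prob_space_std_gaussian)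
  interpret product_sigma_finite "\<lambda>_::nat. std_gaussian k"
    by (intro product_sigma_finite.intro G.sigma_finite_measure_axioms)
  have fI: "finite I" using I finite_subset by blast
  have m: "(\<lambda>x. \<Sum>i\<in>I. \<phi> (x i)) \<in> borel_measurable (covariates n k)"
    using I by (rule measurable_sum_covariates) measurable
  \<comment> \<open>Indices outside \<open>I\<close> get the factor 1, so that the product runs over
    all coordinates of the product measure.\<close>
  let ?f = "\<lambda>i y. if i \<in> I then ennreal (exp (\<phi> y)) else 1"
  have "emeasure (covariates n k) {x \<in> space (covariates n k). T \<le> (\<Sum>i\<in>I. \<phi> (x i))}
      \<le> ennreal (exp (- 1 * T)) * (\<integral>\<^sup>+x. ennreal (exp (1 * (\<Sum>i\<in>I. \<phi> (x i)))) * indicator (space (covariates n k)) x \<partial>covariates n k)"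
    using m by (intro Chernoff_ineq_nn_integral_ge) auto
  also have "(\<integral>\<^sup>+x. ennreal (exp (1 * (\<Sum>i\<in>I. \<phi> (x i)))) * indicator (space (covariates n k)) x \<partial>covariates n k)
      = (\<integral>\<^sup>+x. (\<Prod>i<n. ?f i (x i)) \<partial>covariates n k)"
  proof (intro nn_integral_cong)
    fix x assume "x \<in> space (covariates n k)"
    moreover have "(\<Prod>i<n. ?f i (x i)) = (\<Prod>i\<in>I. ennreal (exp (\<phi> (x i))))"
      using I by (intro prod.mono_neutral_cong_right) auto
    moreover have "\<dots> = ennreal (exp (\<Sum>i\<in>I. \<phi> (x i)))"
      using fI by (simp add: exp_sum prod_ennreal)
    ultimately show "ennreal (exp (1 * (\<Sum>i\<in>I. \<phi> (x i)))) * indicator (space (covariates n k)) x = (\<Prod>i<n. ?f i (x i))"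
      by simp
  qed
  also have "\<dots> = (\<Prod>i<n. \<integral>\<^sup>+y. ?f i y \<partial>std_gaussian k)"
    unfolding covariates_def by (rule product_nn_integral_prod) auto
  also have "\<dots> = (\<Prod>i\<in>I. \<integral>\<^sup>+y. ennreal (exp (\<phi> y)) \<partial>std_gaussian k)"
    using I by (intro prod.mono_neutral_cong_right) (auto simp: G.emeasure_space_1)
  also have "\<dots> \<le> ennreal (exp \<kappa>) ^ card I"
    using mgf by (simp add: power_mono)
  also have "\<dots> = ennreal (exp (\<kappa> * real (card I)))"
    by (simp add: ennreal_power mult.commute flip: exp_of_nat_mult)
  also have "ennreal (exp (- 1 * T)) * \<dots> = ennreal (exp (\<kappa> * real (card I) - T))"
    by (simp flip: ennreal_mult exp_add)
  finally show ?thesis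
    unfolding measure_def by (simp add: enn2real_leI mult_left_mono)
qed

section \<open>Nets and quadratic forms\<close>

lemma sum_half_powers: "(\<Sum>w\<in>{- int B..int B}. (1 / 2 :: real) ^ nat \<bar>w\<bar>) \<le> 3"
proof -
  have "(\<Sum>w\<in>{- int B..int B}. (1 / 2 :: real) ^ nat \<bar>w\<bar>) = 3 - 2 * (1 / 2) ^ B"
  proof (induction B)
    case (Suc B)
    have "{- int (Suc B)..int (Suc B)} = insert (- int (Suc B)) (insert (int (Suc B)) {- int B..int B})"
      by auto
    thus ?case using Suc by (simp add: nat_add_distrib)
  qed auto
  thus ?thesis by simp
qed

text \<open>Every counted vector has weight \<open>g w\<close> at least \<open>(1 / 2) ^ R\<close>,
  while the total weight over the box factors into one-dimensional sums of at most 3 each.\<close>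

lemma card_int_vectors_le:
  fixes k R :: nat
  shows "real (card {w \<in> {..<k} \<rightarrow>\<^sub>E {- int R..int R}. (\<Sum>j<k. nat \<bar>w j\<bar>) \<le> R}) \<le> exp (real R + 2 * real k)"
proof -
  define P where "P = {..<k} \<rightarrow>\<^sub>E {- int R..int R}"
  define W where "W = {w \<in> P. (\<Sum>j<k. nat \<bar>w j\<bar>) \<le> R}"
  define g where "g w = (\<Prod>j<k. (1 / 2 :: real) ^ nat \<bar>w j\<bar>)" for w :: "nat \<Rightarrow> int"
  have finP: "finite P" unfolding P_def by (intro finite_PiE) auto
  have g0: "g w \<ge> 0" for w unfolding g_def by (intro prod_nonneg) auto
  have ge: "(1 / 2) ^ R \<le> g w" if "w \<in> W" for w
  proof -
    have "(1 / 2 :: real) ^ R \<le> (1 / 2) ^ (\<Sum>j<k. nat \<bar>w j\<bar>)"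
      using that by (intro power_decreasing) (auto simp: W_def)
    thus ?thesis by (simp add: g_def power_sum)
  qed
  have "real (card W) * (1 / 2) ^ R \<le> sum g W"
    by (rule sum_bounded_below[OF ge])
  also have "sum g W \<le> sum g P"
    using finP g0 by (intro sum_mono2) (auto simp: W_def)
  also have "sum g P = (\<Prod>j<k. \<Sum>w\<in>{- int R..int R}. (1 / 2) ^ nat \<bar>w\<bar>)"
    unfolding P_def g_def by (rule prod_sum_PiE[symmetric]) auto
  also have "\<dots> \<le> (\<Prod>j<k. 3)"
    by (rule prod_mono) (auto intro: sum_half_powers sum_nonneg)
  finally have "real (card W) \<le> 2 ^ R * 3 ^ k"
    by (simp add: power_one_over field_simps)
  also have "\<dots> \<le> exp 1 ^ R * exp 2 ^ k"
  proof -
    have "(2::real) \<le> exp 1" "(3::real) \<le> exp 2"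
      using exp_ge_add_one_self[of 1] exp_ge_add_one_self[of 2] by simp_all
    thus ?thesis by (intro mult_mono power_mono) auto
  qed
  also have "\<dots> = exp (real R + 2 * real k)"
    by (simp add: exp_add mult.commute flip: exp_of_nat_mult)
  finally show ?thesis by (simp add: W_def P_def)
qed

text \<open>
  The rounding of \<open>u\<close> to the grid of mesh \<open>1 / (512 * sqrt k)\<close> stays within distance \<open>1 / 512\<close>; its
  integer coordinates \<open>w\<close> satisfy \<open>\<Sum>\<bar>w j\<bar> \<le> \<Sum>(w j)\<^sup>2 \<le> 512\<^sup>2 k\<close>, so \<open>1 \<le> 2 ^ (512\<^sup>2 k - \<Sum>\<bar>w j\<bar>)\<close> bounds
  their number by a product of one-dimensional sums.
\<close>

lemma ex_net:
  assumes "k > 0"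
  obtains N :: "rvec set" where "finite N" "real (card N) \<le> exp (262146 * real k)"
    "\<And>v. v \<in> N \<Longrightarrow> 1 / 4 \<le> vnorm k v \<and> vnorm k v \<le> 1"
    "\<And>u. vnorm k u = 1 / 2 \<Longrightarrow> \<exists>v\<in>N. vdist k u v \<le> 1 / 512"
proof -
  define h where "h = 1 / (512 * sqrt (real k))"
  have h: "h > 0" "h\<^sup>2 * (262144 * real k) = 1"
    using assms by (auto simp: h_def power2_eq_square)
  \<comment> \<open>262144 is 512 squared, and the count \<open>exp (R + 2 * k)\<close> turns it
    into 262146.\<close>
  define R where "R = 262144 * k"
  define W where "W = {w \<in> {..<k} \<rightarrow>\<^sub>E {- int R..int R}. (\<Sum>j<k. nat \<bar>w j\<bar>) \<le> R}"
  define f where "f w = (\<lambda>j. h * real_of_int (w j))" for w :: "nat \<Rightarrow> int"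
  have finW: "finite W" 
    by (rule finite_subset[of _ "{..<k} \<rightarrow>\<^sub>E {- int R..int R}"]) (auto simp: W_def intro!: finite_PiE)
  have cardW: "real (card W) \<le> exp (262146 * real k)"
    using card_int_vectors_le[of k R] by (simp add: W_def R_def)
  \<comment> \<open>The norm window is what the moment bounds require of a direction; roundings of
    vectors of norm 1/2 stay inside it.\<close>
  define N where "N = {v \<in> f ` W. 1 / 4 \<le> vnorm k v \<and> vnorm k v \<le> 1}"
  have cov: "\<exists>v\<in>N. vdist k u v \<le> 1 / 512" if u: "vnorm k u = 1 / 2" for u
  proof -
    define w where "w = (\<lambda>j\<in>{..<k}. \<lfloor>u j / h\<rfloor>)"
    have du: "\<bar>u j - f w j\<bar> \<le> h" if "j < k" for j
    proof -
      have "\<bar>u j / h - of_int \<lfloor>u j / h\<rfloor>\<bar> \<le> 1" by linarith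
      hence "h * \<bar>u j / h - of_int \<lfloor>u j / h\<rfloor>\<bar> \<le> h" using h by simp
      also have "h * \<bar>u j / h - of_int \<lfloor>u j / h\<rfloor>\<bar> = \<bar>u j - f w j\<bar>"
        using h that by (simp add: w_def f_def field_simps flip: abs_mult_pos')
      finally show ?thesis .
    qed
    have "(vdist k u (f w))\<^sup>2 \<le> (\<Sum>j<k. h\<^sup>2)"
      unfolding vdist_def vnorm_sq using du by (intro sum_mono) (auto simp: abs_le_square_iff[symmetric] h less_imp_le)
    also have "\<dots> = (1 / 512)\<^sup>2" using h assms by (simp add: h_def power2_eq_square)
    finally have dist: "vdist k u (f w) \<le> 1 / 512" by (rule power2_le_imp_le) simp
    have tri: "\<bar>vnorm k u - vnorm k (f w)\<bar> \<le> vdist k u (f w)"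
    proof -
      have 1: "vnorm k u \<le> vnorm k (f w) + vdist k u (f w)"
        using L2_set_triangle_ineq[of "f w" "\<lambda>j. u j - f w j" "{..<k}"] by (simp add: vnorm_def vdist_def)
      have "vnorm k (f w) \<le> vnorm k u + vnorm k (\<lambda>j. (-1) * (u j - f w j))"
        using L2_set_triangle_ineq[of u "\<lambda>j. (-1) * (u j - f w j)" "{..<k}"] by (simp add: vnorm_def)
      hence "vnorm k (f w) \<le> vnorm k u + vdist k u (f w)"
        unfolding vnorm_cmult vdist_def by simp
      thus ?thesis using 1 by simp
    qed
    have bd: "1 / 4 \<le> vnorm k (f w)" "vnorm k (f w) \<le> 1" using tri dist u by auto
    \<comment> \<open>The norm bound 1, divided by the squared mesh, becomes a bound on the integer
      coordinates.\<close>
    have "h\<^sup>2 * (\<Sum>j<k. (real_of_int (w j))\<^sup>2) = (vnorm k (f w))\<^sup>2"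
      unfolding vnorm_sq f_def by (simp add: power_mult_distrib sum_distrib_left)
    also have "\<dots> \<le> h\<^sup>2 * (262144 * real k)"
      unfolding h using bd vnorm_nonneg[of k "f w"] by (simp add: power_le_one)
    finally have "(\<Sum>j<k. (real_of_int (w j))\<^sup>2) \<le> 262144 * real k"
      by (rule mult_left_le_imp_le) (use h in simp)
    hence sq: "(\<Sum>j<k. (real_of_int (w j))\<^sup>2) \<le> real R" by (simp add: R_def)
    have absle: "real (nat \<bar>i\<bar>) \<le> (real_of_int i)\<^sup>2" for i
    proof -
      have "\<bar>i\<bar> \<le> \<bar>i\<bar> * \<bar>i\<bar>"
        using mult_right_mono[of 1 "\<bar>i\<bar>" "\<bar>i\<bar>"] by (cases "i = 0") auto
      hence "of_int \<bar>i\<bar> \<le> (of_int (\<bar>i\<bar> * \<bar>i\<bar>) :: real)" by (rule of_int_le_iff[THEN iffD2])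
      moreover have "real (nat \<bar>i\<bar>) = of_int \<bar>i\<bar>" by simp
      ultimately show ?thesis by (simp add: power2_eq_square)
    qed
    have "real (\<Sum>j<k. nat \<bar>w j\<bar>) \<le> (\<Sum>j<k. (real_of_int (w j))\<^sup>2)"
      unfolding of_nat_sum by (intro sum_mono absle)
    hence sumR: "(\<Sum>j<k. nat \<bar>w j\<bar>) \<le> R" using sq by linarith
    have "w j \<in> {- int R..int R}" if "j < k" for j
    proof -
      have "nat \<bar>w j\<bar> \<le> (\<Sum>j<k. nat \<bar>w j\<bar>)" using that by (intro member_le_sum) auto
      thus ?thesis using sumR by auto
    qed
    hence "w \<in> {..<k} \<rightarrow>\<^sub>E {- int R..int R}"
      by (intro PiE_I) (simp_all add: w_def restrict_def)
    hence "w \<in> W" using sumR unfolding W_def by blast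
    hence "f w \<in> N" using bd unfolding N_def by blast
    thus ?thesis using dist by blast
  qed
  have "card N \<le> card W"
    unfolding N_def by (rule order.trans[OF card_mono card_image_le]) (use finW in auto)
  hence "real (card N) \<le> exp (262146 * real k)" using cardW by linarith
  moreover have "finite N" using finW by (simp add: N_def)
  moreover have "1 / 4 \<le> vnorm k v \<and> vnorm k v \<le> 1" if "v \<in> N" for v
    using that unfolding N_def by blast
  ultimately show thesis using cov by (intro that)
qed

section \<open>Gram quadratic forms, from a net to all directions\<close>

text \<open>This is the quadratic form of the unnormalized Gram matrix of the samples in
  \<open>I\<close>; bounds of it by multiples of \<open>(vnorm k u)\<^sup>2\<close> stand for
  eigenvalue bounds.\<close>

definition quad :: "nat \<Rightarrow> (nat \<Rightarrow> rvec) \<Rightarrow> nat set \<Rightarrow> rvec \<Rightarrow> real" where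
  "quad k x I u = (\<Sum>i\<in>I. (iprod k (x i) u)\<^sup>2)"

lemma quad_nonneg: "quad k x I u \<ge> 0"
  unfolding quad_def by (simp add: sum_nonneg)

lemma quad_cmult: "quad k x I (\<lambda>j. c * u j) = c\<^sup>2 * quad k x I u"
  unfolding quad_def iprod_cmult_right by (simp add: power_mult_distrib sum_distrib_left)

lemma quad_le_diff: "quad k x I u \<le> 2 * quad k x I v + 2 * quad k x I (\<lambda>j. u j - v j)"
proof -
  have "(p::real)\<^sup>2 \<le> 2 * q\<^sup>2 + 2 * (p - q)\<^sup>2" for p q
    using zero_le_power2[of "p - 2 * q"] by (simp add: power2_eq_square algebra_simps)
  thus ?thesis
    unfolding quad_def iprod_diff_right sum_distrib_left sum.distrib[symmetric] by (intro sum_mono)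
qed

lemma quad_eq_0: "vnorm k u = 0 \<Longrightarrow> quad k x I u = 0"
  unfolding quad_def by (simp add: iprod_eq_0)

lemma quad_scale:
  assumes "vnorm k u > 0"
  obtains w where "vnorm k w = 1 / 2" "quad k x I u = 4 * (vnorm k u)\<^sup>2 * quad k x I w"
proof
  let ?w = "\<lambda>j. (1 / (2 * vnorm k u)) * u j"
  show "vnorm k ?w = 1 / 2" unfolding vnorm_cmult using assms by simp
  show "quad k x I u = 4 * (vnorm k u)\<^sup>2 * quad k x I ?w"
    unfolding quad_cmult using assms by (simp add: power2_eq_square)
qed

text \<open>The supremum \<open>s\<close> over the sphere of radius 1/2 bounds itself: moving to a
  net point costs at most \<open>s / 2\<close>, so \<open>s \<le> 2 * B + s / 2\<close> and
  \<open>s \<le> 4 * B\<close>. Rescaling contributes another factor 4.\<close>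

lemma quad_le_of_net:
  assumes net: "\<And>u. vnorm k u = 1 / 2 \<Longrightarrow> \<exists>v\<in>N. vdist k u v \<le> 1 / 512"
    and B: "\<And>v. v \<in> N \<Longrightarrow> quad k x I v \<le> B"
  shows "quad k x I u \<le> 16 * B * (vnorm k u)\<^sup>2"
proof (cases "vnorm k u = 0")
  case False
  hence pos: "vnorm k u > 0" using vnorm_nonneg[of k u] by simp
  define S where "S = {w. vnorm k w = 1 / 2}"
  define s where "s = (SUP w\<in>S. quad k x I w)"
  obtain w0 where w0: "vnorm k w0 = 1 / 2" "quad k x I u = 4 * (vnorm k u)\<^sup>2 * quad k x I w0"
    using quad_scale[OF pos] by metis
  have ne: "S \<noteq> {}" using w0 by (auto simp: S_def)
  \<comment> \<open>Finiteness of \<open>s\<close>, by Cauchy-Schwarz, is what allows the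
    self-bounding inequality to be solved for \<open>s\<close>.\<close>
  have bdd: "bdd_above (quad k x I ` S)"
  proof (rule bdd_aboveI2)
    fix w assume "w \<in> S"
    hence w: "vnorm k w = 1 / 2" by (simp add: S_def)
    have "(iprod k (x i) w)\<^sup>2 \<le> (vnorm k (x i) * (1 / 2))\<^sup>2" for i
      using iprod_abs_le[of k "x i" w] vnorm_nonneg[of k "x i"] unfolding w
      by (intro abs_le_square_iff[THEN iffD1]) simp
    thus "quad k x I w \<le> (\<Sum>i\<in>I. (vnorm k (x i) * (1 / 2))\<^sup>2)"
      unfolding quad_def by (intro sum_mono)
  qed
  have le_s: "quad k x I w \<le> s" if "vnorm k w = 1 / 2" for w
    unfolding s_def using bdd that by (intro cSUP_upper) (auto simp: S_def)
  have s0: "s \<ge> 0" using le_s[OF w0(1)] quad_nonneg[of k x I w0] by linarith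
  have "s \<le> 2 * B + s / 2"
    unfolding s_def
  proof (rule cSUP_least[OF ne], fold s_def)
    fix w assume "w \<in> S"
    then obtain v where v: "v \<in> N" "vdist k w v \<le> 1 / 512" using net by (auto simp: S_def)
    let ?d = "\<lambda>j. w j - v j"
    have "quad k x I ?d \<le> s / 4"
    proof (cases "vnorm k ?d = 0")
      case True thus ?thesis using s0 by (simp add: quad_eq_0)
    next
      case False
      hence "vnorm k ?d > 0" using vnorm_nonneg[of k ?d] by simp
      then obtain w' where w': "vnorm k w' = 1 / 2" "quad k x I ?d = 4 * (vnorm k ?d)\<^sup>2 * quad k x I w'"
        using quad_scale by metis
      have "(vnorm k ?d)\<^sup>2 \<le> (1 / 512)\<^sup>2"
        using v vnorm_nonneg[of k ?d] by (intro power_mono) (auto simp: vdist_def)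
      hence "4 * (vnorm k ?d)\<^sup>2 \<le> 1 / 4" by (simp add: power2_eq_square)
      hence "4 * (vnorm k ?d)\<^sup>2 * quad k x I w' \<le> 1 / 4 * s"
        using le_s[OF w'(1)] quad_nonneg by (intro mult_mono) auto
      thus ?thesis using w' by simp
    qed
    thus "quad k x I w \<le> 2 * B + s / 2"
      using quad_le_diff[of k x I w v] B[OF v(1)] by linarith
  qed
  hence "quad k x I w0 \<le> 4 * B" using le_s[OF w0(1)] by linarith
  hence "4 * (vnorm k u)\<^sup>2 * quad k x I w0 \<le> 4 * (vnorm k u)\<^sup>2 * (4 * B)"
    by (intro mult_left_mono) auto
  thus ?thesis using w0 by simp
qed (simp add: quad_eq_0)

text \<open>The upper bound controls the rounding error: it is at most
  \<open>256 * m / 512\<^sup>2 = m / 1024\<close>, small against the lower bound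
  \<open>m / 128\<close> on the net. This is where the fine mesh is used.\<close>

lemma quad_ge_of_net:
  assumes net: "\<And>u. vnorm k u = 1 / 2 \<Longrightarrow> \<exists>v\<in>N. vdist k u v \<le> 1 / 512"
    and up: "\<And>v. v \<in> N \<Longrightarrow> quad k x I v \<le> 16 * m"
    and low: "\<And>v. v \<in> N \<Longrightarrow> m / 128 \<le> quad k x I v"
  shows "m / 128 * (vnorm k u)\<^sup>2 \<le> quad k x I u"
proof (cases "vnorm k u = 0")
  case False
  hence pos: "vnorm k u > 0" using vnorm_nonneg[of k u] by simp
  obtain w where w: "vnorm k w = 1 / 2" "quad k x I u = 4 * (vnorm k u)\<^sup>2 * quad k x I w"
    using quad_scale[OF pos] by metis
  obtain v where v: "v \<in> N" "vdist k w v \<le> 1 / 512" using net w by blast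
  let ?d = "\<lambda>j. v j - w j"
  have m0: "m \<ge> 0" using up[OF v(1)] quad_nonneg[of k x I v] by linarith
  have "vnorm k ?d = vdist k w v"
    unfolding vdist_def vnorm_def L2_set_def by (simp add: power2_commute)
  hence "(vnorm k ?d)\<^sup>2 \<le> (1 / 512)\<^sup>2"
    using v vnorm_nonneg[of k ?d] by (intro power_mono) auto
  hence "16 * (16 * m) * (vnorm k ?d)\<^sup>2 \<le> 16 * (16 * m) * (1 / 512)\<^sup>2"
    using m0 by (intro mult_left_mono) auto
  moreover have "quad k x I ?d \<le> 16 * (16 * m) * (vnorm k ?d)\<^sup>2"
    by (rule quad_le_of_net[OF net up])
  ultimately have "quad k x I ?d \<le> m / 1024" by (simp add: power2_eq_square)
  hence "m / 512 \<le> quad k x I w"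
    using quad_le_diff[of k x I v w] low[OF v(1)] m0 by linarith
  hence "4 * (vnorm k u)\<^sup>2 * (m / 512) \<le> quad k x I u"
    unfolding w by (intro mult_left_mono) auto
  thus ?thesis by (simp add: mult.commute)
qed (simp add: quad_eq_0)

section \<open>Deterministic error bound for least squares\<close>

text \<open>
  \<open>P\<close> and \<open>O'\<close> are the samples coming from \<open>\<beta>s\<close> and from \<open>\<beta>o\<close>; \<open>MP\<close> and \<open>MO\<close> contain the misclassified ones.
  Comparing the losses of the minimizer and of \<open>\<beta>s\<close> avoids the normal equations.
\<close>

lemma least_squares_error:
  assumes ls: "least_squares k y x J b" and \<beta>s: "\<beta>s \<in> vecs k"
    and fin: "finite P" "finite O'" "P \<inter> O' = {}" "J \<subseteq> P \<union> O'"
    and yP: "\<And>i. i \<in> P \<Longrightarrow> y i = iprod k (x i) \<beta>s"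
    and yO: "\<And>i. i \<in> O' \<Longrightarrow> y i = iprod k (x i) \<beta>o"
    and MP: "MP \<subseteq> P" "P - MP \<subseteq> J" and MO: "J \<inter> O' \<subseteq> MO" "MO \<subseteq> O'"
    and mis: "\<And>i. i \<in> MO \<Longrightarrow> \<bar>iprod k (x i) \<beta>o - iprod k (x i) \<beta>s\<bar> \<le> \<bar>iprod k (x i) d1\<bar> + \<bar>iprod k (x i) d2\<bar>"
    and d: "vnorm k d1 \<le> e" "vnorm k d2 \<le> e"
    and low: "\<And>u. l * (vnorm k u)\<^sup>2 \<le> quad k x P u"
    and upP: "\<And>u. quad k x MP u \<le> U * (vnorm k u)\<^sup>2"
    and upO: "\<And>u. quad k x MO u \<le> U * (vnorm k u)\<^sup>2"
    and lU: "17 * U \<le> l" "0 \<le> U" "0 < l"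
  shows "vdist k b \<beta>s \<le> e / 2"
proof -
  let ?D = "\<lambda>j. b j - \<beta>s j" and ?f = "\<lambda>\<beta>. \<Sum>i\<in>J. (y i - iprod k (x i) \<beta>)\<^sup>2"
  have finJ: "finite J" using fin finite_subset by blast
  have finMO: "finite MO" using MO fin finite_subset by blast
  have finMP: "finite MP" using MP fin finite_subset by blast
  have e0: "e \<ge> 0" using d vnorm_nonneg[of k d1] by linarith
  have "quad k x P ?D = quad k x (P - MP) ?D + quad k x MP ?D"
    unfolding quad_def using MP fin by (intro sum.subset_diff) auto
  \<comment> \<open>Removing the misclassified samples costs at most \<open>U\<close> of the lower
    eigenvalue bound, so the correctly classified ones retain \<open>l - U\<close>.\<close>
  hence "(l - U) * (vdist k b \<beta>s)\<^sup>2 \<le> quad k x (P - MP) ?D"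
    using low[of ?D] upP[of ?D] by (simp add: vdist_def algebra_simps)
  also have "\<dots> = (\<Sum>i\<in>P - MP. (y i - iprod k (x i) b)\<^sup>2)"
    unfolding quad_def by (intro sum.cong) (auto simp: yP iprod_diff_right power2_commute)
  also have "\<dots> \<le> ?f b" using MP finJ by (intro sum_mono2) auto
  also have "\<dots> \<le> ?f \<beta>s"
    using ls \<beta>s unfolding least_squares_def is_arg_min_def by (auto simp: not_less)
  \<comment> \<open>The truth \<open>\<beta>s\<close> has zero residual on \<open>P\<close>; only
    foreign samples contribute to its loss.\<close>
  also have "\<dots> = (\<Sum>i\<in>J \<inter> O'. (iprod k (x i) \<beta>o - iprod k (x i) \<beta>s)\<^sup>2)"
    using finJ fin yP yO by (intro sum.mono_neutral_cong_right) auto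
  also have "\<dots> \<le> (\<Sum>i\<in>MO. (iprod k (x i) \<beta>o - iprod k (x i) \<beta>s)\<^sup>2)"
    using MO finMO by (intro sum_mono2) auto
  also have "\<dots> \<le> (\<Sum>i\<in>MO. 2 * (iprod k (x i) d1)\<^sup>2 + 2 * (iprod k (x i) d2)\<^sup>2)"
  proof (intro sum_mono)
    fix i assume "i \<in> MO"
    hence "(iprod k (x i) \<beta>o - iprod k (x i) \<beta>s)\<^sup>2 \<le> (\<bar>iprod k (x i) d1\<bar> + \<bar>iprod k (x i) d2\<bar>)\<^sup>2"
      using mis by (intro abs_le_square_iff[THEN iffD1]) auto
    also have "\<dots> \<le> 2 * (iprod k (x i) d1)\<^sup>2 + 2 * (iprod k (x i) d2)\<^sup>2"
      using zero_le_power2[of "\<bar>iprod k (x i) d1\<bar> - \<bar>iprod k (x i) d2\<bar>"]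
      by (simp add: power2_sum power2_diff)
    finally show "(iprod k (x i) \<beta>o - iprod k (x i) \<beta>s)\<^sup>2 \<le> \<dots>" .
  qed
  also have "\<dots> = 2 * quad k x MO d1 + 2 * quad k x MO d2"
    by (simp add: quad_def sum.distrib sum_distrib_left)
  also have "\<dots> \<le> 2 * (U * e\<^sup>2) + 2 * (U * e\<^sup>2)"
  proof (intro add_mono mult_left_mono)
    have "(vnorm k d1)\<^sup>2 \<le> e\<^sup>2" "(vnorm k d2)\<^sup>2 \<le> e\<^sup>2" using d by (auto intro!: power_mono vnorm_nonneg)
    thus "quad k x MO d1 \<le> U * e\<^sup>2" "quad k x MO d2 \<le> U * e\<^sup>2"
      using upO lU by (meson mult_left_mono order.trans)+
  qed auto
  finally have 1: "(l - U) * (vdist k b \<beta>s)\<^sup>2 \<le> 4 * U * e\<^sup>2" by simp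
  have pos: "l - U > 0" using lU by linarith
  \<comment> \<open>Halving the error costs a factor 4 beside the existing 4, hence
    \<open>16 * U \<le> l - U\<close>.\<close>
  have "4 * U * e\<^sup>2 \<le> (l - U) * (e / 2)\<^sup>2"
  proof -
    have "16 * U * e\<^sup>2 \<le> (l - U) * e\<^sup>2" using lU by (intro mult_right_mono) auto
    thus ?thesis by (simp add: power_divide)
  qed
  with 1 have "(l - U) * (vdist k b \<beta>s)\<^sup>2 \<le> (l - U) * (e / 2)\<^sup>2" by linarith
  hence "(vdist k b \<beta>s)\<^sup>2 \<le> (e / 2)\<^sup>2" using pos by simp
  thus ?thesis by (rule power2_le_imp_le) (use e0 in simp)
qed

section \<open>Measurability of the success event\<close>

text \<open>The responses are recomputed from \<open>x\<close>, which makes the loss jointly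
  continuous in the covariates and the candidate vector.\<close>

definition lsq_loss :: "nat \<Rightarrow> rvec \<Rightarrow> rvec \<Rightarrow> (nat \<Rightarrow> real) \<Rightarrow> nat set \<Rightarrow> (nat \<Rightarrow> rvec) \<Rightarrow> rvec \<Rightarrow> real" where
  "lsq_loss k \<beta>1s \<beta>2s z J x b = (\<Sum>i\<in>J. (response k \<beta>1s \<beta>2s z x i - iprod k (x i) b)\<^sup>2)"

lemma least_squares_iff:
  "least_squares k (response k \<beta>1s \<beta>2s z x) x J b \<longleftrightarrow>
     b \<in> vecs k \<and> (\<forall>y\<in>vecs k. lsq_loss k \<beta>1s \<beta>2s z J x b \<le> lsq_loss k \<beta>1s \<beta>2s z J x y)"
  unfolding least_squares_def is_arg_min_def lsq_loss_def by (auto simp: not_less)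

lemma continuous_on_lsq_loss:
  "continuous_on UNIV (\<lambda>p. lsq_loss k \<beta>1s \<beta>2s z J (fst p) (snd p))"
proof -
  have 1: "continuous_on UNIV (\<lambda>p::(nat \<Rightarrow> rvec) \<times> rvec. fst p i j)" for i j
    by (rule continuous_on_product_then_coordinatewise[OF continuous_on_product_then_coordinatewise[OF
        continuous_on_fst[OF continuous_on_id]]])
  have 2: "continuous_on UNIV (\<lambda>p::(nat \<Rightarrow> rvec) \<times> rvec. snd p j)" for j
    by (rule continuous_on_product_then_coordinatewise[OF continuous_on_snd[OF continuous_on_id]])
  show ?thesis unfolding lsq_loss_def response_def iprod_def
    by (intro continuous_intros 1 2)
qed

lemma closed_vecs: "closed (vecs k)"
proof -
  have "closed (\<Inter>j\<in>- {..<k}. {b::rvec. b j = undefined})"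
  proof (rule closed_INT, rule ballI)
    fix j
    show "closed {b::rvec. b j = undefined}"
      by (rule closed_Collect_eq[OF continuous_on_product_coordinates continuous_on_const])
  qed
  also have "(\<Inter>j\<in>- {..<k}. {b::rvec. b j = undefined}) = vecs k"
    unfolding vecs_def PiE_def extensional_def by auto
  finally show ?thesis .
qed

text \<open>Minimality is an intersection, over all competitors \<open>y\<close>, of closed
  conditions comparing two continuous losses, so an uncountable family of competitors does no
  harm.\<close>

lemma closed_least_squares:
  "closed {(x, b). least_squares k (response k \<beta>1s \<beta>2s z x) x J b}"
proof -
  let ?f = "lsq_loss k \<beta>1s \<beta>2s z J"
  have "closed {p. snd p \<in> vecs k}"
    using closed_vimage[OF closed_vecs, of snd k] by (simp add: vimage_def continuous_on_snd continuous_on_id)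
  moreover have "closed (\<Inter>y\<in>vecs k. {p. ?f (fst p) (snd p) \<le> ?f (fst p) y})"
  proof (intro closed_INT ballI closed_Collect_le continuous_on_lsq_loss)
    fix y
    show "continuous_on UNIV (\<lambda>p::(nat \<Rightarrow> rvec) \<times> rvec. ?f (fst p) y)"
      using continuous_on_compose2[OF continuous_on_lsq_loss, of UNIV "\<lambda>p::(nat \<Rightarrow> rvec) \<times> rvec. (fst p, y)"]
      by (simp add: continuous_on_Pair continuous_on_fst continuous_on_id)
  qed
  ultimately have "closed ({p. snd p \<in> vecs k} \<inter> (\<Inter>y\<in>vecs k. {p. ?f (fst p) (snd p) \<le> ?f (fst p) y}))"
    by (rule closed_Int)
  also have "{p. snd p \<in> vecs k} \<inter> (\<Inter>y\<in>vecs k. {p. ?f (fst p) (snd p) \<le> ?f (fst p) y})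
      = {(x, b). least_squares k (response k \<beta>1s \<beta>2s z x) x J b}"
    by (auto simp: least_squares_iff)
  finally show ?thesis .
qed

section \<open>Projections, compact boxes and the Borel structure\<close>

text \<open>Witnesses for a convergent sequence lie in \<open>K\<close>, so a subsequence of them
  converges, and the limit is a witness for the limit point.\<close>

lemma closed_projection_compact:
  fixes C :: "('a::metric_space \<times> 'b::metric_space) set"
  assumes "closed C" "compact K"
  shows "closed {x. \<exists>b\<in>K. (x, b) \<in> C}"
  unfolding closed_sequential_limits
proof (intro allI impI, elim conjE)
  fix X l assume X: "\<forall>n. X n \<in> {x. \<exists>b\<in>K. (x, b) \<in> C}" "X \<longlonglongrightarrow> l"
  hence "\<forall>n. \<exists>b. b \<in> K \<and> (X n, b) \<in> C" by blast
  then obtain B where "\<forall>n. B n \<in> K \<and> (X n, B n) \<in> C" by (rule choice[THEN exE])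
  hence B: "\<And>n. B n \<in> K" "\<And>n. (X n, B n) \<in> C" by auto
  have "seq_compact K" using \<open>compact K\<close> by (simp add: compact_eq_seq_compact_metric)
  then obtain b r where b: "b \<in> K" "strict_mono r" "(B \<circ> r) \<longlonglongrightarrow> b"
    by (rule seq_compactE[of K B]) (use B in auto)
  have "(\<lambda>n. ((X \<circ> r) n, (B \<circ> r) n)) \<longlonglongrightarrow> (l, b)"
    by (rule tendsto_Pair[OF LIMSEQ_subseq_LIMSEQ[OF X(2) b(2)] b(3)])
  hence "(l, b) \<in> C"
    by (rule closed_sequentially[OF \<open>closed C\<close>, rotated]) (use B in simp)
  thus "l \<in> {x. \<exists>b\<in>K. (x, b) \<in> C}" using b by blast
qed

lemma continuous_on_vdist: "continuous_on UNIV (\<lambda>b. vdist k b c)"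
  unfolding vdist_def vnorm_def L2_set_def
  by (intro continuous_intros continuous_on_product_coordinates)

lemma compact_box: "compact {b \<in> vecs k. \<forall>j<k. \<bar>b j\<bar> \<le> m}"
proof -
  \<comment> \<open>Coordinates from \<open>k\<close> on range over the singleton of
    \<open>undefined\<close>, so the box is a product of compact sets over all indices and
    Tychonoff's theorem applies.\<close>
  define S where "S j = (if j < k then {-m..m} else {undefined::real})" for j
  have "compactin (product_topology (\<lambda>_. euclidean) UNIV) (PiE UNIV S)"
    unfolding compactin_PiE by (auto simp: S_def)
  moreover have "PiE UNIV S = {b \<in> vecs k. \<forall>j<k. \<bar>b j\<bar> \<le> m}"
  proof (intro set_eqI iffI)
    fix b assume "b \<in> PiE UNIV S"
    hence b: "b j \<in> S j" for j by auto
    have "b j = undefined" if "\<not> j < k" for j using b[of j] that by (simp add: S_def)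
    moreover have "\<bar>b j\<bar> \<le> m" if "j < k" for j using b[of j] that by (simp add: S_def abs_le_iff)
    ultimately show "b \<in> {b \<in> vecs k. \<forall>j<k. \<bar>b j\<bar> \<le> m}"
      by (simp add: vecs_def PiE_iff extensional_def)
  next
    fix b assume "b \<in> {b \<in> vecs k. \<forall>j<k. \<bar>b j\<bar> \<le> m}"
    hence "b j \<in> S j" for j
      by (cases "j < k") (auto simp: S_def vecs_def PiE_iff extensional_def abs_le_iff)
    thus "b \<in> PiE UNIV S" by auto
  qed
  ultimately show ?thesis by (simp add: euclidean_product_topology)
qed

text \<open>This transfers Borel sets of the full function space, in particular closed ones, to the
  product sigma-algebra of the covariates. Coordinates out of range are constant on the
  space.\<close>

lemma measurable_covariates_borel: "(\<lambda>x. x) \<in> borel_measurable (covariates n k)"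
proof (intro measurable_coordinatewise_then_product)
  fix i j
  have sg: "sets (std_gaussian k) = sets (Pi\<^sub>M {..<k} (\<lambda>_. borel))"
    unfolding std_gaussian_def by (intro sets_PiM_cong) auto
  show "(\<lambda>x. x i j) \<in> borel_measurable (covariates n k)"
  proof (cases "i < n \<and> j < k")
    case True
    have "(\<lambda>y. y j) \<in> borel_measurable (std_gaussian k)"
      using True by (subst measurable_cong_sets[OF sg refl]) simp
    thus ?thesis unfolding covariates_def
      using True by (intro measurable_compose[OF measurable_component_singleton[of i]]) auto
  next
    case False
    have "x i j = (if i < n then undefined else (undefined :: rvec) j)" if "x \<in> space (covariates n k)" for x
      using that False by (auto simp: covariates_def std_gaussian_def space_PiM PiE_iff extensional_def)
    hence "(\<lambda>x. x i j) \<in> borel_measurable (covariates n k) \<longleftrightarrow>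
        (\<lambda>_. if i < n then undefined else (undefined :: rvec) j) \<in> borel_measurable (covariates n k)"
      by (rule measurable_cong)
    thus ?thesis by simp
  qed
qed

text \<open>The set is a countable union of projections of closed sets along compact sets.\<close>

lemma sets_ex_least_squares_far:
  "{x \<in> space (covariates n k). \<exists>b. least_squares k (response k \<beta>1s \<beta>2s z x) x J b \<and> vdist k b c > \<rho>}
     \<in> sets (covariates n k)"
proof -
  \<comment> \<open>One index \<open>m\<close> serves two exhaustions: a growing box for
    compactness, and closed conditions that approximate the strict inequality from inside.\<close>
  define K where "K m = {b \<in> vecs k. \<forall>j<k. \<bar>b j\<bar> \<le> real m} \<inter> {b. \<rho> + 1 / real (Suc m) \<le> vdist k b c}" for m
  define P where "P m = {x. \<exists>b\<in>K m. (x, b) \<in> {(x, b). least_squares k (response k \<beta>1s \<beta>2s z x) x J b}}" for m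
  have "closed {b. \<rho> + 1 / real (Suc m) \<le> vdist k b c}" for m
    by (intro closed_Collect_le continuous_on_const continuous_on_vdist)
  hence "compact (K m)" for m
    unfolding K_def by (intro compact_Int_closed compact_box)
  hence "closed (P m)" for m
    unfolding P_def by (intro closed_projection_compact closed_least_squares)
  hence "(\<Union>m. P m) \<in> sets borel" by (intro sets.countable_UN) auto
  hence "(\<lambda>x. x) -` (\<Union>m. P m) \<inter> space (covariates n k) \<in> sets (covariates n k)"
    by (rule measurable_sets[OF measurable_covariates_borel])
  also have "(\<lambda>x. x) -` (\<Union>m. P m) \<inter> space (covariates n k) =
    {x \<in> space (covariates n k). \<exists>b. least_squares k (response k \<beta>1s \<beta>2s z x) x J b \<and> vdist k b c > \<rho>}"
  proof (intro equalityI subsetI)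
    fix x assume "x \<in> (\<lambda>x. x) -` (\<Union>m. P m) \<inter> space (covariates n k)"
    then obtain m b where *: "x \<in> space (covariates n k)" "b \<in> K m"
      "least_squares k (response k \<beta>1s \<beta>2s z x) x J b"
      by (auto simp: P_def)
    have "0 < 1 / real (Suc m)" by simp
    moreover have "\<rho> + 1 / real (Suc m) \<le> vdist k b c" using * by (simp add: K_def)
    ultimately have "\<rho> < vdist k b c" by linarith
    with * show "x \<in> {x \<in> space (covariates n k). \<exists>b. least_squares k (response k \<beta>1s \<beta>2s z x) x J b \<and> vdist k b c > \<rho>}"
      by blast
  next
    fix x assume "x \<in> {x \<in> space (covariates n k). \<exists>b. least_squares k (response k \<beta>1s \<beta>2s z x) x J b \<and> vdist k b c > \<rho>}"
    then obtain b where x: "x \<in> space (covariates n k)" and b: "least_squares k (response k \<beta>1s \<beta>2s z x) x J b"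
      "vdist k b c > \<rho>" by blast
    obtain N where N: "1 / real (Suc N) < vdist k b c - \<rho>"
      using b(2) nat_approx_posE[of "vdist k b c - \<rho>"] by auto
    define m where "m = max N (nat \<lceil>\<Sum>j<k. \<bar>b j\<bar>\<rceil>)"
    have "1 / real (Suc m) \<le> 1 / real (Suc N)" by (intro divide_left_mono) (auto simp: m_def)
    moreover have "\<bar>b j\<bar> \<le> real m" if "j < k" for j
    proof -
      have "\<bar>b j\<bar> \<le> (\<Sum>j<k. \<bar>b j\<bar>)" using that by (intro member_le_sum) auto
      also have "\<dots> \<le> real (nat \<lceil>\<Sum>j<k. \<bar>b j\<bar>\<rceil>)" by linarith
      also have "\<dots> \<le> real m" by (simp add: m_def)
      finally show ?thesis .
    qed
    moreover have "b \<in> vecs k" using b by (simp add: least_squares_iff)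
    ultimately have "b \<in> K m" using N by (auto simp: K_def)
    thus "x \<in> (\<lambda>x. x) -` (\<Union>m. P m) \<inter> space (covariates n k)"
      using x b by (auto simp: P_def)
  qed
  finally show ?thesis .
qed

text \<open>Needed because \<^const>\<open>measure\<close> is \<open>0\<close> on sets that are not measurable.\<close>

lemma sets_EM_event:
  "{x \<in> space (covariates n k).
     \<forall>b1 b2. EM_step n k (response k \<beta>1s \<beta>2s z x) x \<beta>1 \<beta>2 b1 b2 \<longrightarrow> err k \<beta>1s \<beta>2s b1 b2 \<le> r}
   \<in> sets (covariates n k)"
proof -
  let ?C = "covariates n k" and ?y = "response k \<beta>1s \<beta>2s z"
  define D where "D J c \<rho> = {x \<in> space ?C. \<exists>b. least_squares k (?y x) x J b \<and> vdist k b c > \<rho>}" for J c \<rho>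
  have D [measurable]: "D J c \<rho> \<in> sets ?C" for J c \<rho>
    unfolding D_def by (rule sets_ex_least_squares_far)
  \<comment> \<open>Distances exceed -1, so \<open>D J c (- 1)\<close> merely says that a minimizer
    exists.\<close>
  have vd: "vdist k b c > - 1" for b c
    unfolding vdist_def vnorm_def using L2_set_nonneg[of _ "{..<k}"] by (smt (verit))
  define A where "A J = {x \<in> space ?C. cluster1 n k (?y x) x \<beta>1 \<beta>2 = J}" for J
  have coord [measurable]: "(\<lambda>x. x i j) \<in> borel_measurable ?C" for i j
  proof -
    have "continuous_on UNIV (\<lambda>x::nat \<Rightarrow> rvec. x i j)"
      by (rule continuous_on_product_then_coordinatewise[OF continuous_on_product_then_coordinatewise[OF continuous_on_id]])
    from measurable_compose[OF measurable_covariates_borel borel_measurable_continuous_onI[OF this]]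
    show ?thesis .
  qed
  have A: "A J \<in> sets ?C" for J
  proof -
    define p where "p i x \<longleftrightarrow> \<bar>?y x i - iprod k (x i) \<beta>1\<bar> < \<bar>?y x i - iprod k (x i) \<beta>2\<bar>" for i x
    have p: "Measurable.pred ?C (p i)" for i
      unfolding p_def response_def iprod_def by measurable
    have "A J = (if J \<subseteq> {..<n} then {x \<in> space ?C. \<forall>i\<in>{..<n}. p i x = (i \<in> J)} else {})"
    proof (cases "J \<subseteq> {..<n}")
      case True
      have "cluster1 n k (?y x) x \<beta>1 \<beta>2 = J \<longleftrightarrow> (\<forall>i\<in>{..<n}. p i x = (i \<in> J))" for x
        using True unfolding cluster1_def p_def set_eq_iff mem_Collect_eq by blast
      thus ?thesis using True by (simp add: A_def)
    qed (auto simp: A_def cluster1_def)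
    also have "\<dots> \<in> sets ?C"
    proof -
      have "Measurable.pred ?C (\<lambda>x. \<forall>i\<in>{..<n}. p i x = (i \<in> J))"
        using p by measurable
      thus ?thesis by (simp add: pred_def)
    qed
    finally show ?thesis .
  qed
  \<comment> \<open>Failure is split over the finitely many possible clusters \<open>J\<close>: one
    minimizer is farther than \<open>r\<close>, while the other cluster has a minimizer too, so that
    together they form an EM step.\<close>
  have "{x \<in> space ?C. \<forall>b1 b2. EM_step n k (?y x) x \<beta>1 \<beta>2 b1 b2 \<longrightarrow> err k \<beta>1s \<beta>2s b1 b2 \<le> r}
     = space ?C - (\<Union>J\<in>Pow {..<n}. A J \<inter>
         (D J \<beta>1s r \<inter> D ({..<n} - J) \<beta>2s (- 1) \<union> D J \<beta>1s (- 1) \<inter> D ({..<n} - J) \<beta>2s r))"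
    (is "?L = ?R")
  proof (intro equalityI subsetI)
    fix x assume "x \<in> ?L"
    thus "x \<in> ?R" unfolding A_def D_def EM_step_def cluster2_def err_def by fastforce
  next
    fix x assume xR: "x \<in> ?R"
    hence x: "x \<in> space ?C" by simp
    define J where "J = cluster1 n k (?y x) x \<beta>1 \<beta>2"
    have J: "J \<in> Pow {..<n}" unfolding J_def cluster1_def by auto
    have xA: "x \<in> A J" using x by (simp add: A_def J_def)
    have no: "x \<notin> D J \<beta>1s r \<inter> D ({..<n} - J) \<beta>2s (- 1)" "x \<notin> D J \<beta>1s (- 1) \<inter> D ({..<n} - J) \<beta>2s r"
      using xR J xA by blast+
    show "x \<in> ?L"
    proof (intro CollectI conjI x allI impI)
      fix b1 b2 assume "EM_step n k (?y x) x \<beta>1 \<beta>2 b1 b2"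
      hence ls: "least_squares k (?y x) x J b1" "least_squares k (?y x) x ({..<n} - J) b2"
        by (auto simp: EM_step_def cluster2_def J_def)
      have "x \<in> D J \<beta>1s (- 1)" "x \<in> D ({..<n} - J) \<beta>2s (- 1)"
        using ls vd x by (auto simp: D_def)
      hence "x \<notin> D J \<beta>1s r" "x \<notin> D ({..<n} - J) \<beta>2s r" using no by auto
      hence "vdist k b1 \<beta>1s \<le> r" "vdist k b2 \<beta>2s \<le> r"
        using ls x by (auto simp: D_def not_less)
      thus "err k \<beta>1s \<beta>2s b1 b2 \<le> r" by (simp add: err_def)
    qed
  qed
  also have "?R \<in> sets ?C"
    using A by (intro sets.compl_sets sets.finite_UN sets.Int sets.Un D) auto
  finally show ?thesis .
qed

section \<open>Concentration and the EM step\<close>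

text \<open>For each net direction three Chernoff events are excluded: a large Gram form, a small
  Gram form, and a large Gram form on the slab. A union bound over the net and the net lemmas extend
  the estimates to all directions.\<close>

lemma cluster_bad_event:
  fixes q :: real
  assumes I: "I \<subseteq> {..<n}" and a: "vnorm k a > 0" and b: "vnorm k b \<le> \<epsilon> * vnorm k a"
    and \<epsilon>: "0 < \<epsilon>" "\<epsilon> \<le> 1" and k: "k > 0" and q: "0 \<le> q" "q \<le> real (card I)"
    and \<epsilon>q: "4 * exp 18 * \<epsilon> * real (card I) \<le> q / 2560000"
  obtains B where "B \<in> sets (covariates n k)"
    "measure (covariates n k) B \<le> 3 * exp (262146 * real k - q / 2560000)"
    "\<And>x u. x \<in> space (covariates n k) - B \<Longrightarrow> q / 128 * (vnorm k u)\<^sup>2 \<le> quad k x I u"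
    "\<And>x u. x \<in> space (covariates n k) - B \<Longrightarrow>
        quad k x {i \<in> I. \<bar>iprod k (x i) a\<bar> \<le> \<bar>iprod k (x i) b\<bar>} u \<le> q / 2500 * (vnorm k u)\<^sup>2"
proof -
  let ?C = "covariates n k"
  interpret C: prob_space ?C by (rule prob_space_covariates)
  define m where "m = real (card I)"
  have fI: "finite I" using I finite_subset by blast
  obtain N :: "rvec set" where N: "finite N" "real (card N) \<le> exp (262146 * real k)"
    "\<And>v. v \<in> N \<Longrightarrow> 1 / 4 \<le> vnorm k v \<and> vnorm k v \<le> 1"
    "\<And>u. vnorm k u = 1 / 2 \<Longrightarrow> \<exists>v\<in>N. vdist k u v \<le> 1 / 512"
    using ex_net[OF k] by metis
  define \<phi>1 where "\<phi>1 v y = (iprod k y v)\<^sup>2 / 8" for v y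
  define \<phi>2 where "\<phi>2 v y = - 64 * (iprod k y v)\<^sup>2" for v y
  define \<phi>3 where "\<phi>3 v y = (if \<bar>iprod k y a\<bar> \<le> \<bar>iprod k y b\<bar> then (iprod k y v)\<^sup>2 / 32 else 0)" for v y
  have m1: "\<phi>1 v \<in> borel_measurable (std_gaussian k)" for v unfolding \<phi>1_def by measurable
  have m2: "\<phi>2 v \<in> borel_measurable (std_gaussian k)" for v unfolding \<phi>2_def by measurable
  have m3: "\<phi>3 v \<in> borel_measurable (std_gaussian k)" for v unfolding \<phi>3_def by measurable
  define S where "S \<phi> T = {x \<in> space ?C. T \<le> (\<Sum>i\<in>I. \<phi> (x i))}" for \<phi> :: "rvec \<Rightarrow> real" and T
  have S: "S \<phi> T \<in> sets ?C" if "\<phi> \<in> borel_measurable (std_gaussian k)" for \<phi> T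
    unfolding S_def using measurable_sum_covariates[OF I that] by measurable
  \<comment> \<open>Outside these events the full form lies between \<open>m / 128\<close> and
    \<open>16 * m\<close>, and the slab form is at most \<open>32 * q / 1280000 = q / 40000\<close>,
    which passing to all directions multiplies by 16. Half of the third threshold pays for the slab
    moment, the other half is the probability exponent.\<close>
  define Bv where "Bv v = S (\<phi>1 v) (2 * m) \<union> S (\<phi>2 v) (- m / 2) \<union> S (\<phi>3 v) (q / 1280000)" for v
  have Bv: "Bv v \<in> sets ?C" for v unfolding Bv_def by (intro sets.Un S m1 m2 m3)
  have mBv: "measure ?C (Bv v) \<le> 3 * exp (- q / 2560000)" if v: "v \<in> N" for v
  proof -
    have v1: "vnorm k v \<le> 1" and v2: "vnorm k v \<ge> 1 / 4" using N(3)[OF v] by auto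
    have "ennreal 2 \<le> ennreal (exp 1)" using exp_ge_add_one_self[of 1] by (intro ennreal_leI) simp
    hence "2 \<le> ennreal (exp 1)" by simp
    with nn_integral_exp_iprod_sq_le_2[OF v1]
    have "(\<integral>\<^sup>+y. ennreal (exp (\<phi>1 v y)) \<partial>std_gaussian k) \<le> ennreal (exp 1)"
      unfolding \<phi>1_def by (rule order.trans)
    hence "measure ?C (S (\<phi>1 v) (2 * m)) \<le> exp (1 * m - 2 * m)"
      unfolding S_def m_def by (rule covariates_chernoff[OF I m1])
    also have "\<dots> \<le> exp (- q / 2560000)" using q by (simp add: m_def)
    finally have 1: "measure ?C (S (\<phi>1 v) (2 * m)) \<le> exp (- q / 2560000)" .
    have "(\<integral>\<^sup>+y. ennreal (exp (\<phi>2 v y)) \<partial>std_gaussian k) \<le> ennreal (exp (- 1))"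
      using nn_integral_exp_neg_iprod_sq_le[OF v2] unfolding \<phi>2_def .
    hence "measure ?C (S (\<phi>2 v) (- m / 2)) \<le> exp (- 1 * m - - m / 2)"
      unfolding S_def m_def by (rule covariates_chernoff[OF I m2])
    also have "\<dots> \<le> exp (- q / 2560000)" using q by (simp add: m_def)
    finally have 2: "measure ?C (S (\<phi>2 v) (- m / 2)) \<le> exp (- q / 2560000)" .
    have "(\<integral>\<^sup>+y. ennreal (exp (\<phi>3 v y)) \<partial>std_gaussian k) \<le> ennreal (exp (4 * exp 18 * \<epsilon>))"
      using nn_integral_exp_slab[OF a b \<epsilon> v1] unfolding \<phi>3_def .
    hence "measure ?C (S (\<phi>3 v) (q / 1280000)) \<le> exp (4 * exp 18 * \<epsilon> * m - q / 1280000)"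
      unfolding S_def m_def by (rule covariates_chernoff[OF I m3])
    also have "\<dots> \<le> exp (- q / 2560000)" using \<epsilon>q by (simp add: m_def)
    finally have 3: "measure ?C (S (\<phi>3 v) (q / 1280000)) \<le> exp (- q / 2560000)" .
    have "measure ?C (Bv v) \<le> measure ?C (S (\<phi>1 v) (2 * m)) + measure ?C (S (\<phi>2 v) (- m / 2))
        + measure ?C (S (\<phi>3 v) (q / 1280000))"
      unfolding Bv_def
      by (rule order.trans[OF measure_Un_le add_right_mono[OF measure_Un_le]]) (auto intro!: S m1 m2 m3)
    thus ?thesis using 1 2 3 by linarith
  qed
  define B where "B = (\<Union>v\<in>N. Bv v)"
  have good: "16 * m \<ge> quad k x I v" "m / 128 \<le> quad k x I v"
    "quad k x {i \<in> I. \<bar>iprod k (x i) a\<bar> \<le> \<bar>iprod k (x i) b\<bar>} v \<le> q / 40000"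
    if x: "x \<in> space ?C - B" and v: "v \<in> N" for x v
  proof -
    have no: "x \<notin> S (\<phi>1 v) (2 * m)" "x \<notin> S (\<phi>2 v) (- m / 2)" "x \<notin> S (\<phi>3 v) (q / 1280000)"
      using x v by (auto simp: B_def Bv_def)
    have "(\<Sum>i\<in>I. \<phi>1 v (x i)) = quad k x I v / 8" "(\<Sum>i\<in>I. \<phi>2 v (x i)) = - 64 * quad k x I v"
      unfolding quad_def \<phi>1_def \<phi>2_def by (simp_all add: sum_divide_distrib sum_distrib_left sum_negf)
    thus "16 * m \<ge> quad k x I v" "m / 128 \<le> quad k x I v"
      using no x by (auto simp: S_def)
    have "quad k x {i \<in> I. \<bar>iprod k (x i) a\<bar> \<le> \<bar>iprod k (x i) b\<bar>} v / 32 = (\<Sum>i\<in>I. \<phi>3 v (x i))"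
      unfolding quad_def \<phi>3_def sum_divide_distrib using fI by (rule sum.inter_filter)
    thus "quad k x {i \<in> I. \<bar>iprod k (x i) a\<bar> \<le> \<bar>iprod k (x i) b\<bar>} v \<le> q / 40000"
      using no x by (auto simp: S_def)
  qed
  show thesis
  proof
    show "B \<in> sets ?C" unfolding B_def using N Bv by (intro sets.finite_UN) auto
    have "measure ?C B \<le> (\<Sum>v\<in>N. measure ?C (Bv v))"
      unfolding B_def by (rule measure_UNION_le[OF N(1) Bv])
    also have "\<dots> \<le> real (card N) * (3 * exp (- q / 2560000))"
      by (rule sum_bounded_above[OF mBv])
    also have "\<dots> \<le> exp (262146 * real k) * (3 * exp (- q / 2560000))"
      using N(2) by (intro mult_right_mono) auto
    also have "\<dots> = 3 * exp (262146 * real k - q / 2560000)" by (simp flip: exp_add)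
    finally show "measure ?C B \<le> 3 * exp (262146 * real k - q / 2560000)" .
  next
    fix x u assume x: "x \<in> space ?C - B"
    have "q / 128 * (vnorm k u)\<^sup>2 \<le> m / 128 * (vnorm k u)\<^sup>2"
      using q by (intro mult_right_mono) (auto simp: m_def)
    also have "\<dots> \<le> quad k x I u"
      by (rule quad_ge_of_net[OF N(4) good(1)[OF x] good(2)[OF x]])
    finally show "q / 128 * (vnorm k u)\<^sup>2 \<le> quad k x I u" .
    show "quad k x {i \<in> I. \<bar>iprod k (x i) a\<bar> \<le> \<bar>iprod k (x i) b\<bar>} u \<le> q / 2500 * (vnorm k u)\<^sup>2"
      using quad_le_of_net[OF N(4) good(3)[OF x], of u] by simp
  qed
qed

section \<open>Separation of the parameters and assembly of the EM step\<close>

lemma vdist_commute: "vdist k u v = vdist k v u"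
  unfolding vdist_def vnorm_def L2_set_def by (simp add: power2_commute)

lemma vdist_triangle: "vdist k u w \<le> vdist k u v + vdist k v w"
  using L2_set_triangle_ineq[of "\<lambda>j. u j - v j" "\<lambda>j. v j - w j" "{..<k}"]
  by (simp add: vdist_def vnorm_def)

lemma vdist_pos:
  assumes "u \<in> vecs k" "v \<in> vecs k" "u \<noteq> v"
  shows "vdist k u v > 0"
proof -
  have "vdist k u v \<noteq> 0"
  proof
    assume "vdist k u v = 0"
    hence "\<forall>j\<in>{..<k}. u j = v j"
      unfolding vdist_def vnorm_def by (simp add: L2_set_eq_0_iff)
    thus False using assms unfolding vecs_def by (metis PiE_ext)
  qed
  thus ?thesis using vnorm_nonneg[of k "\<lambda>j. u j - v j"] by (simp add: vdist_def)
qed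

text \<open>The labels are a fixed vector, so the true clusters are fixed index sets. The current
  iterates are fixed as well, so each cluster has one slab that does not depend on the samples, and
  \<open>cluster_bad_event\<close> applies to both.\<close>

lemma EM_event_probability:
  fixes ct c1 :: real
  defines "ct \<equiv> 1 / (8 * exp 18 * 2560000)" and "c1 \<equiv> 2560000 * 262150"
  assumes vecs: "\<beta>1s \<in> vecs k" "\<beta>2s \<in> vecs k" and ne: "\<beta>1s \<noteq> \<beta>2s" and k: "k > 0"
    and z: "\<forall>i<n. z i \<in> {0, 1}" and p: "p1 > 0" "p2 > 0" "p1 + p2 = 1"
    and p1: "p1 = real (card {i \<in> {..<n}. z i = 1}) / real n"
    and p2: "p2 = real (card {i \<in> {..<n}. z i = 0}) / real n"
    and err: "err k \<beta>1s \<beta>2s \<beta>1 \<beta>2 \<le> ct * min p1 p2 * vdist k \<beta>1s \<beta>2s"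
    and n: "real n \<ge> (c1 / min p1 p2) * real k"
  shows "measure (covariates n k) {x \<in> space (covariates n k).
             \<forall>b1 b2. EM_step n k (response k \<beta>1s \<beta>2s z x) x \<beta>1 \<beta>2 b1 b2 \<longrightarrow>
               err k \<beta>1s \<beta>2s b1 b2 \<le> 1 / 2 * err k \<beta>1s \<beta>2s \<beta>1 \<beta>2}
        > 1 - exp (- 1 * real k)"
proof -
  let ?C = "covariates n k"
  interpret C: prob_space ?C by (rule prob_space_covariates)
  define e where "e = err k \<beta>1s \<beta>2s \<beta>1 \<beta>2"
  define q where "q = real n * min p1 p2"
  \<comment> \<open>The factor 2 compensates for the separation, which is only known to be at least
    half of the distance between the true parameters.\<close>
  define \<epsilon> where "\<epsilon> = 2 * ct * min p1 p2"
  define P1 where "P1 = {i \<in> {..<n}. z i = 1}"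
  define P2 where "P2 = {i \<in> {..<n}. z i = 0}"
  have n0: "real n > 0" using p p1 by (cases "n = 0") auto
  have mp: "0 < min p1 p2" "min p1 p2 \<le> 1" using p by auto
  have ct: "0 < ct" "ct \<le> 1 / 2"
    unfolding ct_def using exp_ge_add_one_self[of 18] by (simp_all add: field_simps)
  have \<epsilon>: "0 < \<epsilon>" "\<epsilon> \<le> 1"
    using mp ct mult_mono[of "2 * ct" 1 "min p1 p2" 1] by (auto simp: \<epsilon>_def)
  have card: "real (card P1) = p1 * real n" "real (card P2) = p2 * real n"
    using p1 p2 n0 by (auto simp: P1_def P2_def)
  have q0: "0 \<le> q" using mp by (simp add: q_def)
  have qle: "q \<le> real (card P1)" "q \<le> real (card P2)"
    unfolding card q_def using n0 by (auto simp: mult.commute[of "real n"])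
  have qk: "q \<ge> c1 * real k" using n mp by (simp add: q_def field_simps)
  \<comment> \<open>This equation determines \<open>ct\<close>: the slab moment over all
    \<open>n\<close> samples must stay within \<open>q / 2560000\<close>.\<close>
  have \<epsilon>q: "4 * exp 18 * \<epsilon> * real c \<le> q / 2560000" if "c \<le> n" for c :: nat
  proof -
    have "4 * exp 18 * \<epsilon> * real c \<le> 4 * exp 18 * \<epsilon> * real n" using that \<epsilon> by simp
    also have "\<dots> = q / 2560000" by (simp add: \<epsilon>_def q_def ct_def)
    finally show ?thesis .
  qed
  have cards: "card P1 \<le> n" "card P2 \<le> n"
    using card_mono[of "{..<n}" P1] card_mono[of "{..<n}" P2] by (auto simp: P1_def P2_def)
  have D: "vdist k \<beta>1s \<beta>2s > 0" by (rule vdist_pos[OF vecs ne])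
  have e1: "vdist k \<beta>1s \<beta>1 \<le> e" and e2: "vdist k \<beta>2s \<beta>2 \<le> e"
    using vdist_commute[of k] by (auto simp: e_def err_def)
  have e0: "0 \<le> e" using e1 vnorm_nonneg[of k "\<lambda>j. \<beta>1s j - \<beta>1 j"] by (simp add: vdist_def)
  have e_le: "2 * e \<le> \<epsilon> * vdist k \<beta>1s \<beta>2s" using err by (simp add: e_def \<epsilon>_def)
  have "\<epsilon> * vdist k \<beta>1s \<beta>2s \<le> 1 * vdist k \<beta>1s \<beta>2s"
    using \<epsilon> D by (intro mult_right_mono) auto
  hence e_half: "2 * e \<le> vdist k \<beta>1s \<beta>2s" using e_le by linarith
  have sep1: "vdist k \<beta>1s \<beta>2 \<ge> vdist k \<beta>1s \<beta>2s / 2"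
    using vdist_triangle[of k \<beta>1s \<beta>2s \<beta>2] vdist_commute[of k \<beta>2 \<beta>2s] e2 e_half by linarith
  have sep2: "vdist k \<beta>2s \<beta>1 \<ge> vdist k \<beta>1s \<beta>2s / 2"
    using vdist_triangle[of k \<beta>2s \<beta>1s \<beta>1] vdist_commute[of k \<beta>1 \<beta>1s] vdist_commute[of k \<beta>2s \<beta>1s] e1 e_half
    by linarith
  have small: "e \<le> \<epsilon> * d" if "d \<ge> vdist k \<beta>1s \<beta>2s / 2" for d
  proof -
    have "\<epsilon> * (vdist k \<beta>1s \<beta>2s / 2) \<le> \<epsilon> * d" using that \<epsilon> by (intro mult_left_mono) auto
    thus ?thesis using e_le by simp
  qed
  \<comment> \<open>A sample from \<open>\<beta>1s\<close> has residual
    \<open>\<langle>x, b1v\<rangle>\<close> at \<open>\<beta>1\<close> and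
    \<open>\<langle>x, a1\<rangle>\<close> at \<open>\<beta>2\<close>; \<open>b2v\<close> and
    \<open>a2\<close> play these roles for samples from \<open>\<beta>2s\<close>.\<close>
  define a1 where "a1 = (\<lambda>j. \<beta>1s j - \<beta>2 j)"
  define b1v where "b1v = (\<lambda>j. \<beta>1s j - \<beta>1 j)"
  define a2 where "a2 = (\<lambda>j. \<beta>2s j - \<beta>1 j)"
  define b2v where "b2v = (\<lambda>j. \<beta>2s j - \<beta>2 j)"
  note vdefs = a1_def b1v_def a2_def b2v_def
  have A1: "vnorm k a1 > 0" "vnorm k b1v \<le> \<epsilon> * vnorm k a1"
    using sep1 small[OF sep1] D e1 by (auto simp: vdefs vdist_def)
  have A2: "vnorm k a2 > 0" "vnorm k b2v \<le> \<epsilon> * vnorm k a2"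
    using sep2 small[OF sep2] D e2 by (auto simp: vdefs vdist_def)
  \<comment> \<open>Ties go to the second cluster, so \<open>M1 x\<close> is exactly the
    misclassified part of \<open>P1\<close>, whereas \<open>M2 x\<close> may also contain correctly
    classified ties.\<close>
  define M1 where "M1 x = {i \<in> P1. \<bar>iprod k (x i) a1\<bar> \<le> \<bar>iprod k (x i) b1v\<bar>}" for x
  define M2 where "M2 x = {i \<in> P2. \<bar>iprod k (x i) a2\<bar> \<le> \<bar>iprod k (x i) b2v\<bar>}" for x
  have sub: "P1 \<subseteq> {..<n}" "P2 \<subseteq> {..<n}" by (auto simp: P1_def P2_def)
  obtain B1 where B1: "B1 \<in> sets ?C" "measure ?C B1 \<le> 3 * exp (262146 * real k - q / 2560000)"
    "\<And>x u. x \<in> space ?C - B1 \<Longrightarrow> q / 128 * (vnorm k u)\<^sup>2 \<le> quad k x P1 u"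
    "\<And>x u. x \<in> space ?C - B1 \<Longrightarrow> quad k x (M1 x) u \<le> q / 2500 * (vnorm k u)\<^sup>2"
    using cluster_bad_event[OF sub(1) A1 \<epsilon> k q0 qle(1) \<epsilon>q[OF cards(1)]] unfolding M1_def by blast
  obtain B2 where B2: "B2 \<in> sets ?C" "measure ?C B2 \<le> 3 * exp (262146 * real k - q / 2560000)"
    "\<And>x u. x \<in> space ?C - B2 \<Longrightarrow> q / 128 * (vnorm k u)\<^sup>2 \<le> quad k x P2 u"
    "\<And>x u. x \<in> space ?C - B2 \<Longrightarrow> quad k x (M2 x) u \<le> q / 2500 * (vnorm k u)\<^sup>2"
    using cluster_bad_event[OF sub(2) A2 \<epsilon> k q0 qle(2) \<epsilon>q[OF cards(2)]] unfolding M2_def by blast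
  have qpos: "q > 0" using qk k by (auto simp: c1_def)
  define E where "E = {x \<in> space ?C. \<forall>b1 b2. EM_step n k (response k \<beta>1s \<beta>2s z x) x \<beta>1 \<beta>2 b1 b2 \<longrightarrow>
               err k \<beta>1s \<beta>2s b1 b2 \<le> 1 / 2 * e}"
  have Em: "E \<in> sets ?C" unfolding E_def by (rule sets_EM_event)
  have "space ?C - (B1 \<union> B2) \<subseteq> E"
  proof
    fix x assume x: "x \<in> space ?C - (B1 \<union> B2)"
    hence x1: "x \<in> space ?C - B1" and x2: "x \<in> space ?C - B2" by auto
    let ?y = "response k \<beta>1s \<beta>2s z x"
    have y1: "?y i = iprod k (x i) \<beta>1s" if "i \<in> P1" for i using that by (simp add: response_def P1_def)
    have y2: "?y i = iprod k (x i) \<beta>2s" if "i \<in> P2" for i using that by (simp add: response_def P2_def)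
    have Pun: "P1 \<union> P2 = {..<n}" "P1 \<inter> P2 = {}" using z by (auto simp: P1_def P2_def)
    have fin: "finite P1" "finite P2" by (auto simp: P1_def P2_def)
    note ip = vdefs iprod_diff_right
    have in1: "i \<in> cluster1 n k ?y x \<beta>1 \<beta>2 \<longleftrightarrow> \<bar>iprod k (x i) b1v\<bar> < \<bar>iprod k (x i) a1\<bar>" if "i \<in> P1" for i
      using that sub y1[OF that] by (auto simp: cluster1_def ip)
    have in2: "i \<in> cluster1 n k ?y x \<beta>1 \<beta>2 \<longleftrightarrow> \<bar>iprod k (x i) a2\<bar> < \<bar>iprod k (x i) b2v\<bar>" if "i \<in> P2" for i
      using that sub y2[OF that] by (auto simp: cluster1_def ip)
    have c1n: "cluster1 n k ?y x \<beta>1 \<beta>2 \<subseteq> {..<n}" by (auto simp: cluster1_def)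
    have d: "vnorm k b1v \<le> e" "vnorm k b2v \<le> e" using e1 e2 by (auto simp: vdefs vdist_def)
    show "x \<in> E"
      unfolding E_def
    proof (intro CollectI conjI allI impI)
      show "x \<in> space ?C" using x by simp
      fix b1 b2 assume "EM_step n k ?y x \<beta>1 \<beta>2 b1 b2"
      hence ls1: "least_squares k ?y x (cluster1 n k ?y x \<beta>1 \<beta>2) b1"
        and ls2: "least_squares k ?y x ({..<n} - cluster1 n k ?y x \<beta>1 \<beta>2) b2"
        by (auto simp: EM_step_def cluster2_def)
      have "vdist k b1 \<beta>1s \<le> e / 2"
      proof (rule least_squares_error[OF ls1 vecs(1) fin Pun(2)])
        show "cluster1 n k ?y x \<beta>1 \<beta>2 \<subseteq> P1 \<union> P2" using c1n Pun by simp
        show "M1 x \<subseteq> P1" "P1 - M1 x \<subseteq> cluster1 n k ?y x \<beta>1 \<beta>2" "M2 x \<subseteq> P2"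
          "cluster1 n k ?y x \<beta>1 \<beta>2 \<inter> P2 \<subseteq> M2 x"
          using in1 in2 by (auto simp: M1_def M2_def)
        \<comment> \<open>The difference of the true parameters is \<open>a2 - b1v\<close>, and on
          \<open>M2 x\<close> the form in \<open>a2\<close> is dominated by the one in
          \<open>b2v\<close>.\<close>
        show "\<bar>iprod k (x i) \<beta>2s - iprod k (x i) \<beta>1s\<bar> \<le> \<bar>iprod k (x i) b2v\<bar> + \<bar>iprod k (x i) b1v\<bar>"
          if "i \<in> M2 x" for i using that by (auto simp: M2_def ip)
        show "17 * (q / 2500) \<le> q / 128" "0 \<le> q / 2500" "0 < q / 128" using qpos by auto
      qed (use y1 y2 d B1(3,4)[OF x1] B2(4)[OF x2] in auto)
      moreover have "vdist k b2 \<beta>2s \<le> e / 2"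
      proof (rule least_squares_error[OF ls2 vecs(2) fin(2,1)])
        show "P2 \<inter> P1 = {}" "{..<n} - cluster1 n k ?y x \<beta>1 \<beta>2 \<subseteq> P2 \<union> P1" using Pun by auto
        show "M2 x \<subseteq> P2" "P2 - M2 x \<subseteq> {..<n} - cluster1 n k ?y x \<beta>1 \<beta>2" "M1 x \<subseteq> P1"
          "({..<n} - cluster1 n k ?y x \<beta>1 \<beta>2) \<inter> P1 \<subseteq> M1 x"
          using in1 in2 sub by (auto simp: M1_def M2_def)
        show "\<bar>iprod k (x i) \<beta>1s - iprod k (x i) \<beta>2s\<bar> \<le> \<bar>iprod k (x i) b1v\<bar> + \<bar>iprod k (x i) b2v\<bar>"
          if "i \<in> M1 x" for i using that by (auto simp: M1_def ip)
        show "17 * (q / 2500) \<le> q / 128" "0 \<le> q / 2500" "0 < q / 128" using qpos by auto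
      qed (use y1 y2 d B2(3,4)[OF x2] B1(4)[OF x1] in auto)
      ultimately show "err k \<beta>1s \<beta>2s b1 b2 \<le> 1 / 2 * e" by (simp add: err_def)
    qed
  qed
  hence "measure ?C (space ?C - (B1 \<union> B2)) \<le> measure ?C E"
    by (intro C.finite_measure_mono Em)
  moreover have "measure ?C (space ?C - (B1 \<union> B2)) = 1 - measure ?C (B1 \<union> B2)"
    using B1 B2 by (intro C.prob_compl) auto
  moreover have "measure ?C (B1 \<union> B2) \<le> measure ?C B1 + measure ?C B2"
    using B1 B2 by (intro measure_Un_le)
  \<comment> \<open>262150 is 262146 + 4: the sample size beats the net and leaves
    \<open>exp (- 4 * k)\<close> per cluster. The prefactor 6 is absorbed since
    \<open>6 < 8 \<le> exp 3\<close>.\<close>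
  moreover have "6 * exp (262146 * real k - q / 2560000) < exp (- 1 * real k)"
  proof -
    have "262146 * real k - q / 2560000 \<le> - 4 * real k" using qk by (simp add: c1_def)
    hence "6 * exp (262146 * real k - q / 2560000) \<le> 6 * exp (- 4 * real k)" by simp
    also have "\<dots> < exp (3 * real k) * exp (- 4 * real k)"
    proof (rule mult_strict_right_mono)
      have "(2::real) ^ 3 \<le> exp 1 ^ 3" using exp_ge_add_one_self[of 1] by (intro power_mono) auto
      hence "8 \<le> exp (3::real)" by (simp flip: exp_of_nat_mult)
      also have "\<dots> \<le> exp (3 * real k)" using k by simp
      finally show "6 < exp (3 * real k)" by simp
    qed simp
    also have "\<dots> = exp (- 1 * real k)" by (simp flip: exp_add)
    finally show ?thesis .
  qed
  ultimately show ?thesis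
    using B1(2) B2(2) unfolding E_def e_def by linarith
qed

theorem theorem1:
  "\<exists>ct c1 c2 :: real. ct > 0 \<and> c1 > 0 \<and> c2 > 0 \<and>
     (\<forall>(k::nat) (n::nat) (\<beta>1s::rvec) (\<beta>2s::rvec) (\<beta>1::rvec) (\<beta>2::rvec)
        (z::nat \<Rightarrow> real) (p1::real) (p2::real).
        \<beta>1s \<in> vecs k \<and> \<beta>2s \<in> vecs k \<and> \<beta>1s \<noteq> \<beta>2s \<and> vnorm k \<beta>1s = 1 \<and> vnorm k \<beta>2s = 1 \<and>
        \<beta>1 \<in> vecs k \<and> \<beta>2 \<in> vecs k \<and>
        (\<forall>i<n. z i \<in> {0, 1}) \<and>
        p1 > 0 \<and> p2 > 0 \<and> p1 + p2 = 1 \<and>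
        p1 = real (card {i \<in> {..<n}. z i = 1}) / real n \<and>
        p2 = real (card {i \<in> {..<n}. z i = 0}) / real n \<and>
        err k \<beta>1s \<beta>2s \<beta>1 \<beta>2 \<le> ct * min p1 p2 * vdist k \<beta>1s \<beta>2s \<and>
        real n \<ge> (c1 / min p1 p2) * real k
        \<longrightarrow>
        measure (covariates n k)
          {x \<in> space (covariates n k).
             \<forall>b1 b2. EM_step n k (response k \<beta>1s \<beta>2s z x) x \<beta>1 \<beta>2 b1 b2 \<longrightarrow>
               err k \<beta>1s \<beta>2s b1 b2 \<le> 1 / 2 * err k \<beta>1s \<beta>2s \<beta>1 \<beta>2}
        > 1 - exp (- c2 * real k))"
proof (rule exI[of _ "1 / (8 * exp 18 * 2560000)"], rule exI[of _ "2560000 * 262150"], rule exI[of _ 1],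
    intro conjI allI impI; (elim conjE)?)
  fix k n :: nat and \<beta>1s \<beta>2s \<beta>1 \<beta>2 :: rvec and z :: "nat \<Rightarrow> real" and p1 p2 :: real
  assume "vnorm k \<beta>1s = 1"
  \<comment> \<open>In dimension 0 every norm vanishes, so a unit vector forces
    \<open>k > 0\<close>.\<close>
  hence k: "k > 0" by (cases "k = 0") (auto simp: vnorm_def)
  assume *: "\<beta>1s \<in> vecs k" "\<beta>2s \<in> vecs k" "\<beta>1s \<noteq> \<beta>2s"
    "\<forall>i<n. z i \<in> {0, 1}" "p1 > 0" "p2 > 0" "p1 + p2 = 1"
    "p1 = real (card {i \<in> {..<n}. z i = 1}) / real n"
    "p2 = real (card {i \<in> {..<n}. z i = 0}) / real n"
    "err k \<beta>1s \<beta>2s \<beta>1 \<beta>2 \<le> 1 / (8 * exp 18 * 2560000) * min p1 p2 * vdist k \<beta>1s \<beta>2s"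
    "real n \<ge> (2560000 * 262150 / min p1 p2) * real k"
  show "measure (covariates n k)
          {x \<in> space (covariates n k).
             \<forall>b1 b2. EM_step n k (response k \<beta>1s \<beta>2s z x) x \<beta>1 \<beta>2 b1 b2 \<longrightarrow>
               err k \<beta>1s \<beta>2s b1 b2 \<le> 1 / 2 * err k \<beta>1s \<beta>2s \<beta>1 \<beta>2}
        > 1 - exp (- 1 * real k)"
    by (rule EM_event_probability[OF *(1-3) k *(4-11)])
qed auto

end
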